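(* Let $L,EI,H,E_cA_c,L_c>0$ and $n>0$ be constants, and put $$a=\frac{H}{EI},\qquad b=\frac{8n}{L}\cdot\frac{E_cA_c}{EI\,L_c},\qquad c=\frac{8n}{L}\,b,\qquad \lambda=\frac{L}{100}.$$ Consider the problem $$w''''(x)-\Big(a+b\int_0^L w(t)dt\Big)w''(x)+c\int_0^L w(t)dt=\frac{p(x)}{EI}\ \text{a.e. in }(0,L),\quad w(0)=w(L)=w''(0)=w''(L)=0,\tag{P'}$$ where $p\in L^1[0,L]$, $p\ge0$, $p\not\equiv0$, and $$\frac{p(x)}{EI}\le\Big[\lambda\frac{\pi^4}{L^4}+a\lambda\frac{\pi^2}{L^2}+2b\lambda^2\frac{\pi}{L}\Big]\sin\Big(\frac{\pi}{L}x\Big)+2\lambda c\frac{L}{\pi}\quad\text{a.e. in }(0,L).$$ Then $\alpha\equiv0$ is a lower solution and $\beta(x)=\frac{L}{100}\sin(\frac{\pi}{L}x)$ is an upper solution of (P'). If moreover $n\ge\frac{1}{15.32}$ and $$N:=c\Big(1+\frac{\pi^2}{800n}\Big)\le\frac{4M}{L^3}\sigma(\sqrt M L),\qquad\text{where } M:=a+\frac{cL^3}{400n\pi},$$ then the iterative sequences generated from $y_0\equiv0$ and from $y_0=\frac{L}{100}\sin(\frac{\pi}{L}x)$ both converge uniformly to the unique positive solution of (P') in $\{u\in C^2[0,L]:0\le u\le\beta,\ 0\ge u''\ge\beta''\}$.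
   Context: $\sigma(t):=\dfrac{3t^3}{6t\cosh t+6t-12\sinh t-t^3}$ for $t>0$. Solutions of (P') are in $W^{4,1}[0,L]$. A lower solution of (P') is $\alpha\in W^{4,1}[0,L]$ with $\alpha''''-(a+b\int_0^L\alpha)\alpha''+c\int_0^L\alpha\le p/EI$ a.e. and $\alpha(0)=\alpha(L)=\alpha''(0)=\alpha''(L)=0$; an upper solution has the reversed inequality. Note $M=a+2b\lambda L/\pi$ and $N=c+b\lambda\pi^2/L^2$. The iteration: $y_n\in W^{4,1}[0,L]$ is the unique solution of $y_n''''-My_n''+N\int_0^L y_n=\frac{p}{EI}+b\,y_{n-1}''\int_0^L y_{n-1}-2b\lambda\frac{L}{\pi}y_{n-1}''+b\lambda\frac{\pi^2}{L^2}\int_0^L y_{n-1}$ with $y_n(0)=y_n(L)=y_n''(0)=y_n''(L)=0$, $n\ge1$. (Physically, $n$ is the sag-span ratio, with $q/H=8n/L$.) *)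

theory Defs
  imports "HOL-Analysis.Analysis"
begin

definition sigma :: "real \<Rightarrow> real" where
  "sigma t = 3 * t^3 / (6 * t * cosh t + 6 * t - 12 * sinh t - t^3)"

definition deriv2_on :: "real \<Rightarrow> (real \<Rightarrow> real) \<Rightarrow> (real \<Rightarrow> real) \<Rightarrow> (real \<Rightarrow> real) \<Rightarrow> bool" where
  "deriv2_on L w d1 d2 \<longleftrightarrow>
     (\<forall>x\<in>{0..L}. (w has_real_derivative d1 x) (at x within {0..L})) \<and>
     (\<forall>x\<in>{0..L}. (d1 has_real_derivative d2 x) (at x within {0..L}))"

text \<open>Membership of w in W^{4,1}[0,L]: w, w', w'' differentiable on [0,L] and w''' absolutely
  continuous, i.e. w''' is the indefinite integral of an L^1 function d4 (= w'''' a.e.).\<close>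
definition W41 :: "real \<Rightarrow> (real \<Rightarrow> real) \<Rightarrow> (real \<Rightarrow> real) \<Rightarrow> (real \<Rightarrow> real)
                   \<Rightarrow> (real \<Rightarrow> real) \<Rightarrow> (real \<Rightarrow> real) \<Rightarrow> bool" where
  "W41 L w d1 d2 d3 d4 \<longleftrightarrow>
     deriv2_on L w d1 d2 \<and>
     (\<forall>x\<in>{0..L}. (d2 has_real_derivative d3 x) (at x within {0..L})) \<and>
     set_integrable lborel {0..L} d4 \<and>
     (\<forall>x\<in>{0..L}. d3 x = d3 0 + (LINT t:{0..x}|lborel. d4 t))"

definition hinged_bc :: "real \<Rightarrow> (real \<Rightarrow> real) \<Rightarrow> (real \<Rightarrow> real) \<Rightarrow> bool" where
  "hinged_bc L w d2 \<longleftrightarrow> w 0 = 0 \<and> w L = 0 \<and> d2 0 = 0 \<and> d2 L = 0"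

definition lower_sol :: "real \<Rightarrow> real \<Rightarrow> real \<Rightarrow> real \<Rightarrow> real \<Rightarrow> (real \<Rightarrow> real)
                        \<Rightarrow> (real \<Rightarrow> real) \<Rightarrow> bool" where
  "lower_sol L EI a b c p \<alpha> \<longleftrightarrow> (\<exists>d1 d2 d3 d4. W41 L \<alpha> d1 d2 d3 d4 \<and> hinged_bc L \<alpha> d2 \<and>
     (AE x in lborel. x \<in> {0<..<L} \<longrightarrow>
        d4 x - (a + b * integral {0..L} \<alpha>) * d2 x + c * integral {0..L} \<alpha> \<le> p x / EI))"

definition upper_sol :: "real \<Rightarrow> real \<Rightarrow> real \<Rightarrow> real \<Rightarrow> real \<Rightarrow> (real \<Rightarrow> real)
                        \<Rightarrow> (real \<Rightarrow> real) \<Rightarrow> bool" where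
  "upper_sol L EI a b c p \<beta> \<longleftrightarrow> (\<exists>d1 d2 d3 d4. W41 L \<beta> d1 d2 d3 d4 \<and> hinged_bc L \<beta> d2 \<and>
     (AE x in lborel. x \<in> {0<..<L} \<longrightarrow>
        d4 x - (a + b * integral {0..L} \<beta>) * d2 x + c * integral {0..L} \<beta> \<ge> p x / EI))"

definition is_sol :: "real \<Rightarrow> real \<Rightarrow> real \<Rightarrow> real \<Rightarrow> real \<Rightarrow> (real \<Rightarrow> real)
                        \<Rightarrow> (real \<Rightarrow> real) \<Rightarrow> bool" where
  "is_sol L EI a b c p w \<longleftrightarrow> (\<exists>d1 d2 d3 d4. W41 L w d1 d2 d3 d4 \<and> hinged_bc L w d2 \<and>
     (AE x in lborel. x \<in> {0<..<L} \<longrightarrow>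
        d4 x - (a + b * integral {0..L} w) * d2 x + c * integral {0..L} w = p x / EI))"

text \<open>The iteration: y 0 = y0 on [0,L], and y (k+1) solves the linear problem with
  M = a + 2 b lam L/pi and N = c + b lam pi^2/L^2, right-hand side built from y k.\<close>
definition iter_seq :: "real \<Rightarrow> real \<Rightarrow> real \<Rightarrow> real \<Rightarrow> real \<Rightarrow> real \<Rightarrow> (real \<Rightarrow> real)
                        \<Rightarrow> (real \<Rightarrow> real) \<Rightarrow> (nat \<Rightarrow> real \<Rightarrow> real) \<Rightarrow> bool" where
  "iter_seq L EI a b c lam p y0 y \<longleftrightarrow>
     (\<forall>x\<in>{0..L}. y 0 x = y0 x) \<and>
     (\<forall>k. \<exists>e1 e2 d1 d2 d3 d4. deriv2_on L (y k) e1 e2 \<and>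
        W41 L (y (Suc k)) d1 d2 d3 d4 \<and> hinged_bc L (y (Suc k)) d2 \<and>
        (AE x in lborel. x \<in> {0<..<L} \<longrightarrow>
           d4 x - (a + 2 * b * lam * L / pi) * d2 x
             + (c + b * lam * pi^2 / L^2) * integral {0..L} (y (Suc k))
           = p x / EI + b * e2 x * integral {0..L} (y k) - 2 * b * lam * (L / pi) * e2 x
             + b * lam * (pi^2 / L^2) * integral {0..L} (y k)))"

text \<open>The order interval {u in C^2[0,L] : 0 \<le> u \<le> beta, 0 \<ge> u'' \<ge> beta''}, with
  beta x = lam sin(pi x / L), so beta'' x = - lam (pi/L)^2 sin(pi x / L).\<close>
definition sector :: "real \<Rightarrow> real \<Rightarrow> (real \<Rightarrow> real) set" where
  "sector L lam = {u. \<exists>u1 u2. deriv2_on L u u1 u2 \<and> continuous_on {0..L} u2 \<and>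
      (\<forall>x\<in>{0..L}. 0 \<le> u x \<and> u x \<le> lam * sin (pi / L * x) \<and>
                   u2 x \<le> 0 \<and> - lam * (pi / L)^2 * sin (pi / L * x) \<le> u2 x)}"

end

theory Submission
  imports Defs
begin

text \<open>
  Order functions by \<open>u \<le> w\<close> and \<open>u'' \<ge> w''\<close>. The operator \<open>w'''' - M w'' + N \<integral>w\<close> with hinged ends is
  inverse-positive for this order if \<open>N \<le> 4 M \<sigma>(\<surd>M L) / L\<^sup>3\<close>: the kernel of the map from the
  right-hand side to \<open>v = - w''\<close> is the Dirichlet kernel of \<open>- v'' + M v\<close> minus a rank-one term, and by
  concavity the quotient of the two is smallest at the corner \<open>(0, L)\<close>. On the sector the
  right-hand side of the iteration is monotone, so the iterates \<open>y\<^sub>k\<close> from \<open>0\<close> increase, the iterates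
  \<open>z\<^sub>k\<close> from \<open>\<beta>\<close> decrease, and every solution in the sector lies between them. Integrating the equation
  of \<open>z\<^sub>k - y\<^sub>k\<close> over the interval shows that \<open>M \<integral>(y\<^sub>k'' - z\<^sub>k'') + N L \<integral>(z\<^sub>k - y\<^sub>k)\<close> decays
  geometrically, because \<open>a > 0\<close> and \<open>c > 0\<close>. This gives existence, uniqueness and uniform
  convergence at once.
\<close>

section \<open>Concavity and integration by parts\<close>

text \<open>The bilinear term \<open>b * e * J\<close>, with \<open>e\<close> the second derivative
  and \<open>J\<close> the integral of an iterate, is not monotone in the order, since a larger
  iterate has smaller \<open>e\<close> and larger \<open>J\<close>. The shifts repair this:
  \<open>M = a + b * B\<close> and \<open>N = c + b * K\<close>, where \<open>B\<close> is the
  integral of \<beta> and \<open>K\<close> the maximum of the negated second derivative of \<beta>.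
  Then \<open>e * J - B * e + K * J = B * K - (e + K) * (B - J)\<close>, and on the sector both
  factors are nonnegative and shrink as the iterate grows. The price is the term
  \<open>N * \<integral>w\<close> on the left, which works against positivity; the bound with
  \<open>sigma\<close> says how much of it the kernel tolerates. The strict gaps
  \<open>M - b * B = a\<close> and \<open>N - b * K = c\<close> make the ratio
  \<open>q = max (b * B / M) (b * K / N)\<close> less than 1. Since \<open>p\<close> is only
  integrable, the fourth derivative exists only almost everywhere and cannot be evaluated at an
  extremum. Its sign is therefore always exploited under an integral, against a kernel or a
  constant.\<close>

lemma mvt_Icc:
  fixes f f' :: "real \<Rightarrow> real"
  assumes "\<And>t. t \<in> {\<alpha>..\<beta>} \<Longrightarrow> (f has_real_derivative f' t) (at t within {\<alpha>..\<beta>})"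
    and "\<alpha> \<le> x" "x < y" "y \<le> \<beta>"
  shows "\<exists>\<xi>\<in>{x<..<y}. f y - f x = (y - x) * f' \<xi>"
proof -
  have "(f has_derivative (\<lambda>h. f' t * h)) (at t within {x..y})" if "x \<le> t" "t \<le> y" for t
  proof -
    have "(f has_real_derivative f' t) (at t within {x..y})"
      using assms that by (intro DERIV_subset[OF assms(1)]) auto
    then show ?thesis by (simp add: has_field_derivative_def)
  qed
  from mvt_simple[OF \<open>x < y\<close> this] show ?thesis by (auto simp: mult.commute)
qed

lemma has_real_derivative_within_unique:
  fixes f g :: "real \<Rightarrow> real"
  assumes "\<alpha> < \<beta>" "x \<in> {\<alpha>..\<beta>}"
    and "(f has_real_derivative D) (at x within {\<alpha>..\<beta>})"
    and "(g has_real_derivative E) (at x within {\<alpha>..\<beta>})"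
    and "\<And>t. t \<in> {\<alpha>..\<beta>} \<Longrightarrow> f t = g t"
  shows "D = E"
proof -
  have "(f has_real_derivative E) (at x within {\<alpha>..\<beta>})"
    by (rule has_field_derivative_transform_within[OF assms(4) zero_less_one]) (use assms in auto)
  then show ?thesis
    using assms vector_derivative_unique_within_closed_interval[of \<alpha> \<beta> x f D E]
    by (simp add: has_real_derivative_iff_has_vector_derivative)
qed

text \<open>The definitions of the problem hide derivatives behind existential quantifiers, so
  second derivatives from different witnesses have to be identified, at the end points through
  one-sided derivatives.\<close>

lemma deriv2_on_unique:
  assumes "0 < L" "deriv2_on L u u1 u2" "deriv2_on L w w1 w2"
    and "\<And>x. x \<in> {0..L} \<Longrightarrow> u x = w x"
  shows "\<And>x. x \<in> {0..L} \<Longrightarrow> u2 x = w2 x"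
proof -
  have 1: "u1 x = w1 x" if "x \<in> {0..L}" for x
    by (rule has_real_derivative_within_unique[of 0 L x u _ w])
      (use assms that in \<open>auto simp: deriv2_on_def\<close>)
  show "u2 x = w2 x" if "x \<in> {0..L}" for x
    by (rule has_real_derivative_within_unique[of 0 L x u1 _ w1])
      (use assms 1 that in \<open>auto simp: deriv2_on_def\<close>)
qed

lemma has_real_derivative_Icc_continuous_on:
  fixes f :: "real \<Rightarrow> real"
  assumes "\<And>x. x \<in> S \<Longrightarrow> (f has_real_derivative f' x) (at x within S)"
  shows "continuous_on S f"
  unfolding continuous_on_eq_continuous_within using DERIV_continuous[OF assms] by blast

lemma deriv2_on_continuous:
  assumes "deriv2_on L w d1 d2"
  shows "continuous_on {0..L} w" "continuous_on {0..L} d1"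
  using assms unfolding deriv2_on_def
  by (auto intro!: has_real_derivative_Icc_continuous_on)

lemma deriv2_on_diff:
  assumes "deriv2_on L u u1 u2" "deriv2_on L w w1 w2"
  shows "deriv2_on L (\<lambda>x. u x - w x) (\<lambda>x. u1 x - w1 x) (\<lambda>x. u2 x - w2 x)"
  using assms unfolding deriv2_on_def by (auto intro!: derivative_intros)

lemma deriv2_on_antimono:
  assumes w: "deriv2_on L w d1 d2" and d2: "\<And>x. x \<in> {0..L} \<Longrightarrow> d2 x \<le> 0"
    and st: "0 \<le> s" "s \<le> t" "t \<le> L"
  shows "d1 t \<le> d1 s"
proof (cases "s = t")
  case False
  have "\<And>t. t \<in> {0..L} \<Longrightarrow> (d1 has_real_derivative d2 t) (at t within {0..L})"
    using w unfolding deriv2_on_def by auto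
  from mvt_Icc[of 0 L d1 d2 s t, OF this] False st
  obtain \<xi> where \<xi>: "\<xi> \<in> {s<..<t}" "d1 t - d1 s = (t - s) * d2 \<xi>" by force
  moreover have "(t - s) * d2 \<xi> \<le> 0"
    using st \<xi>(1) by (intro mult_nonneg_nonpos d2) auto
  ultimately show ?thesis by simp
qed simp

text \<open>The mean value theorem from either end gives \<open>w x = x * d1 \<xi>\<close> and
  \<open>- w x = (L - x) * d1 \<eta>\<close> with \<xi> left of \<eta>. As \<open>d1\<close>
  decreases, a negative value is impossible, and the extreme slopes \<open>d1 0\<close> and
  \<open>d1 L\<close> give the tangent bounds.\<close>

lemma concave_vanishing_ends:
  assumes w: "deriv2_on L w d1 d2" and d2: "\<And>x. x \<in> {0..L} \<Longrightarrow> d2 x \<le> 0"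
    and "w 0 = 0" "w L = 0" and x: "x \<in> {0..L}"
  shows "0 \<le> w x" "w x \<le> d1 0 * x" "w x \<le> - d1 L * (L - x)"
proof -
  have w': "\<And>t. t \<in> {0..L} \<Longrightarrow> (w has_real_derivative d1 t) (at t within {0..L})"
    using w unfolding deriv2_on_def by auto
  note anti = deriv2_on_antimono[OF w d2]
  have left: "\<exists>\<xi>. 0 \<le> \<xi> \<and> \<xi> \<le> x \<and> w x = x * d1 \<xi>"
  proof (cases "x = 0")
    case False
    with mvt_Icc[of 0 L w d1 0 x, OF w'] x obtain \<xi> where "\<xi> \<in> {0<..<x}" "w x - w 0 = (x - 0) * d1 \<xi>"
      by auto
    with \<open>w 0 = 0\<close> show ?thesis by (intro exI[of _ \<xi>]) auto
  qed (use \<open>w 0 = 0\<close> in auto)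
  have right: "\<exists>\<xi>. x \<le> \<xi> \<and> \<xi> \<le> L \<and> - w x = (L - x) * d1 \<xi>"
  proof (cases "x = L")
    case False
    with mvt_Icc[of 0 L w d1 x L, OF w'] x obtain \<xi> where "\<xi> \<in> {x<..<L}" "w L - w x = (L - x) * d1 \<xi>"
      by auto
    with \<open>w L = 0\<close> show ?thesis by (intro exI[of _ \<xi>]) auto
  qed (use \<open>w L = 0\<close> in auto)
  from left obtain \<xi> where \<xi>: "0 \<le> \<xi>" "\<xi> \<le> x" "w x = x * d1 \<xi>" by blast
  from right obtain \<eta> where \<eta>: "x \<le> \<eta>" "\<eta> \<le> L" "- w x = (L - x) * d1 \<eta>" by blast
  show "w x \<le> d1 0 * x"
    using \<xi> anti[of 0 \<xi>] x by (simp add: mult.commute mult_left_mono)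
  have "(L - x) * d1 L \<le> (L - x) * d1 \<eta>"
    using \<eta> anti[of \<eta> L] x by (intro mult_left_mono) auto
  then show "w x \<le> - d1 L * (L - x)"
    using \<eta>(3) by (simp add: algebra_simps)
  show "0 \<le> w x"
  proof (rule ccontr)
    assume neg: "\<not> 0 \<le> w x"
    then have "x \<noteq> L" using \<open>w L = 0\<close> by auto
    from neg have "d1 \<xi> < 0" using \<xi> x by (auto simp: not_le mult_less_0_iff)
    then have "d1 \<eta> < 0" using anti[of \<xi> \<eta>] \<xi> \<eta> by linarith
    then have "(L - x) * d1 \<eta> \<le> 0" using x by (intro mult_nonneg_nonpos) auto
    with \<eta>(3) neg show False by linarith
  qed
qed

section \<open>Integration by parts for absolutely continuous functions\<close>

lemma LINT_Icc_eq_integral: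
  fixes f :: "real \<Rightarrow> real"
  assumes "continuous_on {\<alpha>..\<beta>} f"
  shows "(LINT t:{\<alpha>..\<beta>}|lborel. f t) = integral {\<alpha>..\<beta>} f"
  using set_borel_integral_eq_integral(2)[OF borel_integrable_atLeastAtMost'[OF assms]] .

lemma LINT_Icc_FTC:
  fixes f f' :: "real \<Rightarrow> real"
  assumes "\<And>t. t \<in> {\<alpha>..\<beta>} \<Longrightarrow> (f has_real_derivative f' t) (at t within {\<alpha>..\<beta>})"
    and "continuous_on {\<alpha>..\<beta>} f'" and "\<alpha> \<le> x" "x \<le> y" "y \<le> \<beta>"
  shows "(LINT t:{x..y}|lborel. f' t) = f y - f x"
proof -
  have "(f' has_integral (f y - f x)) {x..y}"
  proof (rule fundamental_theorem_of_calculus)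
    fix t assume "t \<in> {x..y}"
    then have "(f has_real_derivative f' t) (at t within {x..y})"
      using assms by (intro DERIV_subset[OF assms(1)]) auto
    then show "(f has_vector_derivative f' t) (at t within {x..y})"
      by (simp add: has_real_derivative_iff_has_vector_derivative)
  qed fact
  moreover have "continuous_on {x..y} f'"
    using assms by (auto intro: continuous_on_subset)
  ultimately show ?thesis by (simp add: LINT_Icc_eq_integral integral_unique)
qed

lemma set_integrable_mult_continuous:
  fixes h d :: "real \<Rightarrow> real"
  assumes h: "continuous_on {\<alpha>..\<beta>} h" and d: "set_integrable lborel {\<alpha>..\<beta>} d"
  shows "set_integrable lborel {\<alpha>..\<beta>} (\<lambda>t. h t * d t)"
proof -
  obtain B where B: "\<And>t. t \<in> {\<alpha>..\<beta>} \<Longrightarrow> \<bar>h t\<bar> \<le> B"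
    using compact_imp_bounded[OF compact_continuous_image[OF h]] unfolding bounded_iff by fastforce
  have hm: "(\<lambda>t. indicator {\<alpha>..\<beta>} t * h t) \<in> borel_measurable lborel"
    using borel_integrable_atLeastAtMost'[OF h] unfolding set_integrable_def by (simp add: borel_measurable_integrable)
  have dm: "(\<lambda>t. indicator {\<alpha>..\<beta>} t * d t) \<in> borel_measurable lborel"
    using d unfolding set_integrable_def by (simp add: borel_measurable_integrable)
  \<comment> \<open>Each factor is known to be measurable only after cutting off, so the indicator
    is duplicated.\<close>
  have eq: "(\<lambda>t. indicator {\<alpha>..\<beta>} t * (h t * d t)) =
      (\<lambda>t. (indicator {\<alpha>..\<beta>} t * h t) * (indicator {\<alpha>..\<beta>} t * d t))"
    by (auto simp: indicator_def)
  show ?thesis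
  proof (rule set_integrable_bound[where f = "\<lambda>t. B * d t"])
    show "set_integrable lborel {\<alpha>..\<beta>} (\<lambda>t. B * d t)" using d by simp
    show "set_borel_measurable lborel {\<alpha>..\<beta>} (\<lambda>t. h t * d t)"
      unfolding set_borel_measurable_def real_scaleR_def eq
      using hm dm by (rule borel_measurable_times)
    have "norm (h t * d t) \<le> norm (B * d t)" if "t \<in> {\<alpha>..\<beta>}" for t
      using B[OF that] by (simp add: abs_mult mult_right_mono)
    then show "AE t in lborel. t \<in> {\<alpha>..\<beta>} \<longrightarrow> norm (h t * d t) \<le> norm (B * d t)" by simp
  qed
qed

text \<open>As \<open>d\<close> is merely integrable, the fundamental theorem used for continuous
  integrands does not apply to \<open>h * D\<close>. The formula is Fubini for
  \<open>d s * h' t\<close> on the triangle \<open>0 \<le> s \<le> t \<le> x\<close>.\<close>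

lemma LINT_by_parts_AC:
  fixes d D h h' :: "real \<Rightarrow> real"
  assumes "0 \<le> x" and d: "set_integrable lborel {0..x} d"
    and D: "\<And>t. t \<in> {0..x} \<Longrightarrow> D t = D 0 + (LINT s:{0..t}|lborel. d s)"
    and h: "\<And>t. t \<in> {0..x} \<Longrightarrow> (h has_real_derivative h' t) (at t within {0..x})"
    and h': "continuous_on {0..x} h'" and Dc: "continuous_on {0..x} D"
  shows "(LINT t:{0..x}|lborel. h t * d t)
    = h x * D x - h 0 * D 0 - (LINT t:{0..x}|lborel. h' t * D t)"
proof -
  define dd where "dd = (\<lambda>s. indicator {0..x} s * d s)"
  define hh where "hh = (\<lambda>t. indicator {0..x} t * h' t)"
  have dd: "integrable lborel dd"
    using d unfolding set_integrable_def dd_def by simp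
  have hh: "integrable lborel hh"
    using borel_integrable_atLeastAtMost'[OF h'] unfolding set_integrable_def hh_def by simp
  have [measurable]: "dd \<in> borel_measurable borel" "hh \<in> borel_measurable borel"
    using borel_measurable_integrable[OF dd] borel_measurable_integrable[OF hh] by simp_all
  have prod: "integrable (lborel \<Otimes>\<^sub>M lborel) (\<lambda>(s, t). dd s * hh t)"
  proof (rule lborel_pair.Fubini_integrable)
    show "integrable lborel (\<lambda>s. LINT t|lborel. norm (case (s, t) of (s, t) \<Rightarrow> dd s * hh t))"
      using dd by (simp add: abs_mult)
    show "AE s in lborel. integrable lborel (\<lambda>t. case (s, t) of (s, t) \<Rightarrow> dd s * hh t)"
      using hh by simp
  qed measurable
  define f where "f = (\<lambda>s t. dd s * hh t * indicator {s..} t)"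
  have fm: "case_prod f \<in> borel_measurable (lborel \<Otimes>\<^sub>M lborel)"
  proof -
    have eq: "case_prod f = (\<lambda>z. dd (fst z) * hh (snd z) * (if fst z \<le> snd z then 1 else 0))"
      by (auto simp: f_def indicator_def fun_eq_iff)
    show ?thesis unfolding eq by measurable
  qed
  have "integrable (lborel \<Otimes>\<^sub>M lborel) (case_prod f)"
    by (rule Bochner_Integration.integrable_bound[OF prod fm])
      (auto simp: f_def indicator_def)
  then have Fub: "(LINT t|lborel. LINT s|lborel. f s t) = (LINT s|lborel. LINT t|lborel. f s t)"
    by (rule lborel_pair.Fubini_integral)
  have inner_t: "(LINT t|lborel. f s t) = indicator {0..x} s * (h x * d s - h s * d s)" for s
  proof (cases "s \<in> {0..x}")
    case True
    have "(LINT t|lborel. f s t) = (LINT t|lborel. d s * (indicator {s..x} t * h' t))"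
      using True by (intro Bochner_Integration.integral_cong) (auto simp: f_def dd_def hh_def indicator_def)
    also have "\<dots> = d s * (LINT t:{s..x}|lborel. h' t)"
      by (simp add: set_lebesgue_integral_def)
    also have "\<dots> = d s * (h x - h s)"
      using True LINT_Icc_FTC[OF h h', of s x] by simp
    finally show ?thesis using True by (simp add: algebra_simps)
  qed (simp add: f_def dd_def)
  have inner_s: "(LINT s|lborel. f s t) = indicator {0..x} t * (h' t * D t - D 0 * h' t)" for t
  proof (cases "t \<in> {0..x}")
    case True
    have "(LINT s|lborel. f s t) = (LINT s|lborel. h' t * (indicator {0..t} s * d s))"
      using True by (intro Bochner_Integration.integral_cong) (auto simp: f_def dd_def hh_def indicator_def)
    also have "\<dots> = h' t * (LINT s:{0..t}|lborel. d s)"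
      by (simp add: set_lebesgue_integral_def)
    also have "\<dots> = h' t * (D t - D 0)" using D[OF True] by simp
    finally show ?thesis using True by (simp add: algebra_simps)
  qed (simp add: f_def hh_def)
  have hc: "continuous_on {0..x} h" by (rule has_real_derivative_Icc_continuous_on[OF h])
  have "h x * (D x - D 0) - (LINT s:{0..x}|lborel. h s * d s)
      = (LINT s:{0..x}|lborel. h x * d s - h s * d s)"
    using d D[of x] \<open>0 \<le> x\<close>
    by (subst set_integral_diff(2)) (auto intro!: set_integrable_mult_continuous[OF hc])
  also have "\<dots> = (LINT t:{0..x}|lborel. h' t * D t - D 0 * h' t)"
    using Fub unfolding inner_t inner_s by (simp add: set_lebesgue_integral_def)
  also have "\<dots> = (LINT t:{0..x}|lborel. h' t * D t) - D 0 * (h x - h 0)"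
    using LINT_Icc_FTC[OF h h', of 0 x] \<open>0 \<le> x\<close>
    by (subst set_integral_diff(2)) (auto intro!: borel_integrable_atLeastAtMost' continuous_intros h' Dc)
  finally show ?thesis by argo
qed

section \<open>The maximum principle for the nonlocal operator\<close>

lemma LINT_Icc_combine:
  fixes f :: "real \<Rightarrow> real"
  assumes "set_integrable lborel {\<alpha>..\<beta>} f" "\<alpha> \<le> x" "x \<le> \<beta>"
  shows "(LINT t:{\<alpha>..x}|lborel. f t) + (LINT t:{x..\<beta>}|lborel. f t) = (LINT t:{\<alpha>..\<beta>}|lborel. f t)"
proof -
  have "set_integrable lborel {\<alpha>..x} f" "set_integrable lborel {x..\<beta>} f"
    using assms by (auto intro: set_integrable_subset)
  then show ?thesis
    using assms Henstock_Kurzweil_Integration.integral_combine[of \<alpha> x \<beta> f]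
    by (simp add: set_borel_integral_eq_integral)
qed

lemma AE_Ioo_imp_AE_Icc:
  fixes P :: "real \<Rightarrow> bool"
  assumes "AE t in lborel. t \<in> {\<alpha><..<\<beta>} \<longrightarrow> P t"
  shows "AE t in lborel. t \<in> {\<alpha>..\<beta>} \<longrightarrow> P t"
  using assms AE_lborel_singleton[of \<alpha>] AE_lborel_singleton[of \<beta>]
  by eventually_elim auto

section \<open>Calculus in the space \<open>W41\<close>\<close>

lemma W41_derivs:
  assumes "W41 L w d1 d2 d3 d4"
  shows "deriv2_on L w d1 d2"
    and "\<And>t. t \<in> {0..L} \<Longrightarrow> (w has_real_derivative d1 t) (at t within {0..L})"
    and "\<And>t. t \<in> {0..L} \<Longrightarrow> (d1 has_real_derivative d2 t) (at t within {0..L})"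
    and "\<And>t. t \<in> {0..L} \<Longrightarrow> (d2 has_real_derivative d3 t) (at t within {0..L})"
    and "set_integrable lborel {0..L} d4"
    and "\<And>t. t \<in> {0..L} \<Longrightarrow> d3 t = d3 0 + (LINT s:{0..t}|lborel. d4 s)"
  using assms unfolding W41_def deriv2_on_def by blast+

lemma W41_continuous:
  assumes "W41 L w d1 d2 d3 d4"
  shows "continuous_on {0..L} w" "continuous_on {0..L} d1" "continuous_on {0..L} d2"
    "continuous_on {0..L} d3"
proof -
  note W = W41_derivs[OF assms]
  show "continuous_on {0..L} w" "continuous_on {0..L} d1" "continuous_on {0..L} d2"
    using has_real_derivative_Icc_continuous_on[OF W(2)] has_real_derivative_Icc_continuous_on[OF W(3)]
      has_real_derivative_Icc_continuous_on[OF W(4)] by auto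
  have "continuous_on {0..L} (\<lambda>t. d3 0 + integral {0..t} d4)"
    using W(5) by (intro continuous_intros indefinite_integral_continuous_1 set_borel_integral_eq_integral(1))
  moreover have "d3 t = d3 0 + integral {0..t} d4" if "t \<in> {0..L}" for t
  proof -
    have "set_integrable lborel {0..t} d4"
      by (rule set_integrable_subset[OF W(5)]) (use that in auto)
    then show ?thesis using W(6)[OF that] by (simp add: set_borel_integral_eq_integral(2))
  qed
  ultimately show "continuous_on {0..L} d3"
    using continuous_on_eq[of "{0..L}" "\<lambda>t. d3 0 + integral {0..t} d4" d3] by metis
qed

lemma W41_diff:
  assumes "W41 L u u1 u2 u3 u4" "W41 L w w1 w2 w3 w4"
  shows "W41 L (\<lambda>x. u x - w x) (\<lambda>x. u1 x - w1 x) (\<lambda>x. u2 x - w2 x) (\<lambda>x. u3 x - w3 x) (\<lambda>x. u4 x - w4 x)"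
proof -
  note U = W41_derivs[OF assms(1)] and W = W41_derivs[OF assms(2)]
  have "u3 t - w3 t = u3 0 - w3 0 + (LINT s:{0..t}|lborel. u4 s - w4 s)" if "t \<in> {0..L}" for t
  proof -
    have "set_integrable lborel {0..t} u4" "set_integrable lborel {0..t} w4"
      by (rule set_integrable_subset[OF U(5)] set_integrable_subset[OF W(5)]; use that in auto)+
    then show ?thesis using U(6)[OF that] W(6)[OF that] by simp
  qed
  then show ?thesis
    unfolding W41_def using U(1-5) W(1-5)
    by (intro conjI ballI deriv2_on_diff derivative_intros set_integral_diff)
qed

lemma W41_cmult:
  assumes "W41 L w w1 w2 w3 w4"
  shows "W41 L (\<lambda>x. r * w x) (\<lambda>x. r * w1 x) (\<lambda>x. r * w2 x) (\<lambda>x. r * w3 x) (\<lambda>x. r * w4 x)"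
proof -
  note W = W41_derivs[OF assms]
  show ?thesis
    unfolding W41_def deriv2_on_def
  proof (intro conjI ballI)
    fix t assume t: "t \<in> {0..L}"
    show "r * w3 t = r * w3 0 + (LINT s:{0..t}|lborel. r * w4 s)"
      using W(6)[OF t] by (simp add: algebra_simps)
  qed (use W(1-5) in \<open>auto intro!: derivative_eq_intros\<close>)
qed

lemma W41_cong:
  assumes "W41 L w d1 d2 d3 d4" "\<And>x. x \<in> {0..L} \<Longrightarrow> d2 x = e2 x"
  shows "W41 L w d1 e2 d3 d4"
proof -
  note W = W41_derivs[OF assms(1)]
  have "(e2 has_real_derivative d3 t) (at t within {0..L})" if "t \<in> {0..L}" for t
    by (rule has_field_derivative_transform_within[OF W(4)[OF that] zero_less_one])
      (use that assms(2) in auto)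
  moreover have "(d1 has_real_derivative e2 t) (at t within {0..L})" if "t \<in> {0..L}" for t
    using W(3)[OF that] assms(2)[OF that] by simp
  ultimately show ?thesis unfolding W41_def deriv2_on_def using W(2,5,6) by blast
qed

text \<open>The first integration by parts goes through the absolutely continuous \<open>d3\<close>,
  the second is classical. Arbitrary limits are allowed because the Dirichlet kernel has a kink on
  the diagonal and is used on each side of it.\<close>

lemma W41_Green:
  assumes w: "W41 L w d1 d2 d3 d4" and h: "deriv2_on L h h1 h2" and h2: "continuous_on {0..L} h2"
    and xy: "0 \<le> x" "x \<le> y" "y \<le> L"
  shows "(LINT t:{x..y}|lborel. h t * d4 t - h2 t * d2 t)
    = (h y * d3 y - h1 y * d2 y) - (h x * d3 x - h1 x * d2 x)"
proof -
  note W = W41_derivs[OF w] and Wc = W41_continuous[OF w]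
  have h': "\<And>t. t \<in> {0..L} \<Longrightarrow> (h has_real_derivative h1 t) (at t within {0..L})"
    and h1': "\<And>t. t \<in> {0..L} \<Longrightarrow> (h1 has_real_derivative h2 t) (at t within {0..L})"
    using h unfolding deriv2_on_def by auto
  note hc = deriv2_on_continuous[OF h]
  have int: "set_integrable lborel {0..L} (\<lambda>t. h t * d4 t - h2 t * d2 t)"
    by (intro set_integral_diff set_integrable_mult_continuous hc W(5)
        borel_integrable_atLeastAtMost' continuous_intros h2 Wc)
  have from0: "(LINT t:{0..z}|lborel. h t * d4 t - h2 t * d2 t)
      = (h z * d3 z - h1 z * d2 z) - (h 0 * d3 0 - h1 0 * d2 0)" if z: "0 \<le> z" "z \<le> L" for z
  proof -
    have sub: "{0..z} \<subseteq> {0..L}" using z by auto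
    have i4: "set_integrable lborel {0..z} d4"
      by (rule set_integrable_subset[OF W(5)]) (use z in auto)
    have c: "continuous_on {0..z} h" "continuous_on {0..z} h1" "continuous_on {0..z} h2"
        "continuous_on {0..z} d2" "continuous_on {0..z} d3"
      using hc h2 Wc continuous_on_subset[OF _ sub] by blast+
    have "(LINT t:{0..z}|lborel. h t * d4 t) = h z * d3 z - h 0 * d3 0 - (LINT t:{0..z}|lborel. h1 t * d3 t)"
    proof (rule LINT_by_parts_AC[OF \<open>0 \<le> z\<close> i4 _ _ c(2) c(5)])
      show "d3 t = d3 0 + (LINT s:{0..t}|lborel. d4 s)" if "t \<in> {0..z}" for t
        using W(6)[of t] that sub by auto
      show "(h has_real_derivative h1 t) (at t within {0..z})" if "t \<in> {0..z}" for t
        using DERIV_subset[OF h'[of t] sub] that sub by auto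
    qed
    moreover have "(LINT t:{0..z}|lborel. h1 t * d3 t + h2 t * d2 t) = h1 z * d2 z - h1 0 * d2 0"
    proof (rule LINT_Icc_FTC[where \<alpha> = 0 and \<beta> = L])
      show "((\<lambda>t. h1 t * d2 t) has_real_derivative h1 t * d3 t + h2 t * d2 t) (at t within {0..L})"
        if "t \<in> {0..L}" for t
        using h1'[OF that] W(4)[OF that] by (auto intro!: derivative_eq_intros)
    qed (use z in \<open>auto intro!: continuous_intros hc h2 Wc\<close>)
    moreover have "(LINT t:{0..z}|lborel. h1 t * d3 t + h2 t * d2 t)
        = (LINT t:{0..z}|lborel. h1 t * d3 t) + (LINT t:{0..z}|lborel. h2 t * d2 t)"
      by (intro set_integral_add borel_integrable_atLeastAtMost' continuous_intros c)
    moreover have "(LINT t:{0..z}|lborel. h t * d4 t - h2 t * d2 t)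
        = (LINT t:{0..z}|lborel. h t * d4 t) - (LINT t:{0..z}|lborel. h2 t * d2 t)"
      by (intro set_integral_diff set_integrable_mult_continuous i4
          borel_integrable_atLeastAtMost' continuous_intros c)
    ultimately show ?thesis by linarith
  qed
  have "set_integrable lborel {0..y} (\<lambda>t. h t * d4 t - h2 t * d2 t)"
    by (rule set_integrable_subset[OF int]) (use xy in auto)
  from LINT_Icc_combine[OF this xy(1,2)] from0[of x] from0[of y] xy show ?thesis by linarith
qed

lemma sinh_ge_self:
  fixes t :: real assumes "0 \<le> t" shows "t \<le> sinh t"
  using real_le_x_sinh[OF assms] by (simp add: sinh_field_def exp_minus)

section \<open>Nonnegativity of the kernel of the nonlocal operator\<close>

locale linear_beam =
  fixes L m N :: real
  assumes L: "0 < L" and m: "0 < m" and N: "0 \<le> N"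
    and N_le: "N * (6 * (m * L) * cosh (m * L) + 6 * (m * L) - 12 * sinh (m * L) - (m * L)^3) \<le> 12 * m^5"
begin

abbreviation "S \<equiv> sinh (m * L)"
abbreviation "C \<equiv> cosh (m * L)"

text \<open>Up to constant factors, \<open>I\<close> and \<open>P\<close> solve \<open>- v'' + m\<^sup>2 v = g\<close> with Dirichlet conditions for
  \<open>g = 1\<close> and \<open>g = x (L - x) / 2\<close>; integrating \<open>- w''\<close> against the latter weight gives \<open>\<integral>w\<close>.\<close>

definition "I x = (S - sinh (m * x) - sinh (m * (L - x))) / m"

definition "P x = m^2 * S * (x * (L - x) / 2) - S + sinh (m * x) + sinh (m * (L - x))"
definition "P1 x = m^2 * S * (L / 2 - x) + m * cosh (m * x) - m * cosh (m * (L - x))"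
definition "P2 x = m^2 * (sinh (m * x) + sinh (m * (L - x)) - S)"

text \<open>The determinant of the rank-one perturbation: testing
  \<open>w'''' - m^2 * w'' + N * \<integral>w = f\<close> with \<open>P\<close> gives
  \<open>Q * \<integral>w = \<integral>P * f\<close>.\<close>

definition "Q = m^4 * S + N * (LINT t:{0..L}|lborel. P t)"

lemma S_pos: "0 < S" and C_ge_1: "1 \<le> C"
  using L m by (auto simp: cosh_real_ge_1)

lemma sinh_sum_le: 
  assumes "x \<in> {0..L}" shows "sinh (m * x) + sinh (m * (L - x)) \<le> S"
proof -
  have "S = sinh (m * x + m * (L - x))" by (simp add: algebra_simps)
  also have "\<dots> = sinh (m * x) * cosh (m * (L - x)) + cosh (m * x) * sinh (m * (L - x))"
    by (rule sinh_add)
  also have "\<dots> \<ge> sinh (m * x) * 1 + 1 * sinh (m * (L - x))"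
    using assms m by (intro add_mono mult_left_mono mult_right_mono) (auto simp: cosh_real_ge_1)
  finally show ?thesis by simp
qed

lemma deriv2_on_P: "deriv2_on L P P1 P2"
  unfolding deriv2_on_def P_def P1_def P2_def
  by (auto intro!: derivative_eq_intros simp: field_simps power2_eq_square)

text \<open>\<open>P\<close> is concave because \<open>sinh\<close> is superadditive on nonnegative
  arguments, and the slope in the bounds is \<open>P1 0 = - P1 L\<close>.\<close>

lemma P_bounds:
  assumes "x \<in> {0..L}"
  shows "0 \<le> P x" "P x \<le> (m^2 * S * L / 2 - m * (C - 1)) * x"
    "P x \<le> (m^2 * S * L / 2 - m * (C - 1)) * (L - x)"
proof -
  have "P2 x \<le> 0" if "x \<in> {0..L}" for x
    using sinh_sum_le[OF that] by (auto simp: P2_def intro!: mult_nonneg_nonpos)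
  note * = concave_vanishing_ends[OF deriv2_on_P this _ _ assms]
  have [simp]: "P 0 = 0" "P L = 0" by (auto simp: P_def)
  show "0 \<le> P x" "P x \<le> (m^2 * S * L / 2 - m * (C - 1)) * x"
    "P x \<le> (m^2 * S * L / 2 - m * (C - 1)) * (L - x)"
    using * by (auto simp: P1_def algebra_simps)
qed

lemma I_bounds:
  assumes "x \<in> {0..L}"
  shows "0 \<le> I x" "I x \<le> (C - 1) * x" "I x \<le> (C - 1) * (L - x)"
proof -
  have I2: "deriv2_on L I (\<lambda>x. cosh (m * (L - x)) - cosh (m * x)) (\<lambda>x. - m * (sinh (m * x) + sinh (m * (L - x))))"
    using m unfolding deriv2_on_def I_def
    by (auto intro!: derivative_eq_intros simp: field_simps)
  note * = concave_vanishing_ends[OF I2 _ _ _ assms]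
  have [simp]: "I 0 = 0" "I L = 0" by (auto simp: I_def)
  show "0 \<le> I x" "I x \<le> (C - 1) * x" "I x \<le> (C - 1) * (L - x)"
    using * m by (auto simp: mult_nonneg_nonneg)
qed

lemma LINT_sinh:
  assumes "x \<in> {0..L}"
  shows "(LINT t:{0..x}|lborel. sinh (m * t)) = (cosh (m * x) - 1) / m"
    "(LINT t:{x..L}|lborel. sinh (m * (L - t))) = (cosh (m * (L - x)) - 1) / m"
proof -
  have "(LINT t:{0..x}|lborel. sinh (m * t)) = cosh (m * x) / m - cosh (m * 0) / m"
    by (rule LINT_Icc_FTC[where \<alpha> = 0 and \<beta> = L])
      (use m assms in \<open>auto intro!: derivative_eq_intros continuous_intros\<close>)
  then show "(LINT t:{0..x}|lborel. sinh (m * t)) = (cosh (m * x) - 1) / m"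
    by (simp add: diff_divide_distrib)
  have "(LINT t:{x..L}|lborel. sinh (m * (L - t))) = - cosh (m * (L - L)) / m - - cosh (m * (L - x)) / m"
    by (rule LINT_Icc_FTC[where \<alpha> = 0 and \<beta> = L])
      (use m assms in \<open>auto intro!: derivative_eq_intros continuous_intros\<close>)
  then show "(LINT t:{x..L}|lborel. sinh (m * (L - t))) = (cosh (m * (L - x)) - 1) / m"
    by (simp add: diff_divide_distrib)
qed

lemma continuous_P: "continuous_on {0..L} P"
  using deriv2_on_continuous[OF deriv2_on_P] by blast

lemma LINT_P: "(LINT t:{0..L}|lborel. P t) = m^2 * S * L^3 / 12 - S * L + 2 * (C - 1) / m"
proof -
  define G where "G = (\<lambda>t. m^2 * S * (L * t^2 / 4 - t^3 / 6) - S * t + cosh (m * t) / m - cosh (m * (L - t)) / m)"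
  have "(LINT t:{0..L}|lborel. P t) = G L - G 0"
  proof (rule LINT_Icc_FTC[where \<alpha> = 0 and \<beta> = L])
    show "(G has_real_derivative P t) (at t within {0..L})" for t
      unfolding G_def P_def using m
      by (auto intro!: derivative_eq_intros simp: field_simps power2_eq_square)
  qed (use L continuous_P in auto)
  also have "\<dots> = m^2 * S * L^3 / 12 - S * L + 2 * (C - 1) / m"
    using m by (simp add: G_def field_simps power2_eq_square power3_eq_cube)
  finally show ?thesis .
qed

lemma Q_pos: "0 < Q"
proof -
  have "0 \<le> (LINT t:{0..L}|lborel. P t)"
    unfolding set_lebesgue_integral_def using P_bounds(1)
    by (intro integral_nonneg_AE) (auto simp: indicator_def)
  then show ?thesis using S_pos m N by (auto simp: Q_def intro!: add_pos_nonneg)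
qed

text \<open>This is the sign of the kernel at the corner \<open>(0, L)\<close> to leading order:
  \<open>C - 1\<close> and \<open>m^2 * S * L / 2 - m * (C - 1)\<close> are the end slopes of
  \<open>I\<close> and \<open>P\<close>, and \<open>m^2\<close> comes from the two
  \<open>sinh\<close> factors. Up to a positive factor the difference of the sides is exactly that
  of \<open>N_le\<close>, which explains the denominator of \<open>sigma\<close>.\<close>

lemma N_le_Q: "N * (C - 1) * (m^2 * S * L / 2 - m * (C - 1)) \<le> m^2 * Q"
proof -
  let ?D = "6 * (m * L) * C + 6 * (m * L) - 12 * S - (m * L)^3"
  have sq: "C^2 = S^2 + 1" by (rule cosh_square_eq)
  have "12 * (N * (C - 1) * (m^2 * S * L / 2 - m * (C - 1)) - m^2 * Q)
      = m * S * (N * ?D - 12 * m^5)"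
  proof -
    have "12 * (N * (C - 1) * (m^2 * S * L / 2 - m * (C - 1)) - m^2 * Q)
      = N * (6 * m^2 * S * L * (C - 1) - 12 * m * (C - 1)^2 - m^4 * S * L^3 + 12 * m^2 * S * L - 24 * m * (C - 1)) - 12 * m^6 * S"
      using m unfolding Q_def LINT_P by (simp add: field_simps power2_eq_square power3_eq_cube eval_nat_numeral)
    \<comment> \<open>\<open>(C - 1)^2 + 2 * (C - 1) = C^2 - 1 = S^2\<close>, which makes
      \<open>S\<close> a common factor.\<close>
    also have "\<dots> = N * (6 * m^2 * S * L * (C + 1) - 12 * m * S^2 - m^4 * S * L^3) - 12 * m^6 * S"
      using sq by algebra
    also have "\<dots> = m * S * (N * ?D - 12 * m^5)"
      by algebra
    finally show ?thesis .
  qed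
  also have "\<dots> \<le> 0" using N_le S_pos m by (intro mult_nonneg_nonpos) auto
  finally show ?thesis by simp
qed

text \<open>Up to the factor \<^term>\<open>Q\<close>, the kernel of the solution operator of the nonlocal problem is
  the Dirichlet kernel minus a rank-one term. Both are compared with products of distances to the
  end points, where the corner \<open>(0, L)\<close> is the critical one.\<close>

lemma kernel_nonneg:
  assumes "0 \<le> s" "s \<le> r" "r \<le> L"
  shows "N * I r * P s \<le> Q * (sinh (m * (L - r)) * sinh (m * s))"
    and "N * I s * P r \<le> Q * (sinh (m * s) * sinh (m * (L - r)))"
proof -
  let ?p = "m^2 * S * L / 2 - m * (C - 1)"
  have "N * ((C - 1) * ?p) * ((L - r) * s) \<le> m^2 * Q * ((L - r) * s)"
    using N_le_Q assms by (intro mult_right_mono) (auto simp: mult.assoc)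
  also have "\<dots> = Q * ((m * (L - r)) * (m * s))" by (simp add: power2_eq_square)
  also have "\<dots> \<le> Q * (sinh (m * (L - r)) * sinh (m * s))"
    using assms m Q_pos by (intro mult_left_mono mult_mono sinh_ge_self) auto
  finally have *: "N * ((C - 1) * ?p) * ((L - r) * s) \<le> Q * (sinh (m * (L - r)) * sinh (m * s))" .
  have "I r * P s \<le> ((C - 1) * (L - r)) * (?p * s)"
    using assms I_bounds[of r] P_bounds[of s] by (intro mult_mono) auto
  from mult_left_mono[OF this N] * show "N * I r * P s \<le> Q * (sinh (m * (L - r)) * sinh (m * s))"
    by (simp add: mult_ac)
  have "I s * P r \<le> ((C - 1) * s) * (?p * (L - r))"
    using assms I_bounds[of s] P_bounds[of r] by (intro mult_mono) auto
  from mult_left_mono[OF this N] * show "N * I s * P r \<le> Q * (sinh (m * s) * sinh (m * (L - r)))"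
    by (simp add: mult_ac)
qed

text \<open>With \<open>v = - w''\<close> and \<open>J = \<integral>w\<close>, the equation reads
  \<open>- v'' + m^2 * v = f - N * J\<close>. Solving by the Dirichlet kernel and eliminating
  \<open>J\<close> through \<open>J * Q = \<integral>P * f\<close> writes
  \<open>Q * m * S * v x\<close> as the integral of \<open>f\<close> against the kernel of
  \<open>kernel_nonneg\<close>.\<close>

lemma maximum_principle_deriv2:
  assumes w: "W41 L w d1 d2 d3 d4" and bc: "hinged_bc L w d2"
    and ineq: "AE t in lborel. t \<in> {0<..<L} \<longrightarrow> 0 \<le> d4 t - m^2 * d2 t + N * integral {0..L} w"
    and x: "x \<in> {0..L}"
  shows "d2 x \<le> 0"
proof -
  note W = W41_derivs[OF w] and Wc = W41_continuous[OF w]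
  have bc': "w 0 = 0" "w L = 0" "d2 0 = 0" "d2 L = 0" using bc by (auto simp: hinged_bc_def)
  define J where "J = integral {0..L} w"
  define f where "f = (\<lambda>t. d4 t - m^2 * d2 t + N * J)"
  have f_int: "set_integrable lborel {\<alpha>..\<beta>} (\<lambda>t. h t * f t)"
    if "0 \<le> \<alpha>" "\<beta> \<le> L" "continuous_on {0..L} h" for h \<alpha> \<beta>
  proof -
    have "set_integrable lborel {0..L} f"
      unfolding f_def
      by (intro set_integral_add set_integral_diff W(5))
        (intro borel_integrable_atLeastAtMost' continuous_intros Wc)+
    then have "set_integrable lborel {0..L} (\<lambda>t. h t * f t)"
      by (rule set_integrable_mult_continuous[OF that(3)])
    then show ?thesis by (rule set_integrable_subset) (use that in auto)
  qed
  have LINT_f: "(LINT t:{\<alpha>..\<beta>}|lborel. h t * f t)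
      = (h \<beta> * d3 \<beta> - h1 \<beta> * d2 \<beta>) - (h \<alpha> * d3 \<alpha> - h1 \<alpha> * d2 \<alpha>)
        + (LINT t:{\<alpha>..\<beta>}|lborel. (h2 t - m^2 * h t) * d2 t) + N * J * (LINT t:{\<alpha>..\<beta>}|lborel. h t)"
    if "0 \<le> \<alpha>" "\<alpha> \<le> \<beta>" "\<beta> \<le> L" and h: "deriv2_on L h h1 h2" "continuous_on {0..L} h2" for h h1 h2 \<alpha> \<beta>
  proof -
    note hc = deriv2_on_continuous[OF h(1)]
    have sub: "{\<alpha>..\<beta>} \<subseteq> {0..L}" using that by auto
    have c: "continuous_on {\<alpha>..\<beta>} h" "continuous_on {\<alpha>..\<beta>} h2" "continuous_on {\<alpha>..\<beta>} d2"
      using hc h(2) Wc continuous_on_subset[OF _ sub] by blast+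
    have i4: "set_integrable lborel {\<alpha>..\<beta>} d4"
      by (rule set_integrable_subset[OF W(5)]) (use sub in auto)
    have "(LINT t:{\<alpha>..\<beta>}|lborel. h t * f t)
      = (LINT t:{\<alpha>..\<beta>}|lborel. ((h t * d4 t - h2 t * d2 t) + (h2 t - m^2 * h t) * d2 t) + N * J * h t)"
      by (intro set_lebesgue_integral_cong) (auto simp: f_def algebra_simps)
    also have "\<dots> = ((LINT t:{\<alpha>..\<beta>}|lborel. h t * d4 t - h2 t * d2 t)
        + (LINT t:{\<alpha>..\<beta>}|lborel. (h2 t - m^2 * h t) * d2 t)) + (LINT t:{\<alpha>..\<beta>}|lborel. N * J * h t)"
      by (subst set_integral_add(2); (subst set_integral_add(2))?; 
        (intro set_integral_add set_integral_diff set_integrable_mult_continuous i4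
          borel_integrable_atLeastAtMost' continuous_intros c refl)?)
    finally show ?thesis
      using W41_Green[OF w h that(1-3)] by simp
  qed
  have L0: "0 \<le> L" using L by simp
  \<comment> \<open>The weight \<open>t * (L - t) / 2\<close> vanishes at both ends and has second
    derivative -1, so integrating \<open>d2\<close> against it returns \<open>- J\<close>.\<close>
  have JQ: "(LINT t:{0..L}|lborel. P t * f t) = J * Q"
  proof -
    have "(LINT t:{0..L}|lborel. (t * (L - t) / 2) * d2 t + w t)
        = ((L * (L - L) / 2) * d1 L - (L / 2 - L) * w L) - ((0 * (L - 0) / 2) * d1 0 - (L / 2 - 0) * w 0)"
      by (rule LINT_Icc_FTC[where \<alpha> = 0 and \<beta> = L])
        (use L0 in \<open>auto intro!: derivative_eq_intros W(2,3) continuous_intros Wc simp: field_simps\<close>)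
    then have "(LINT t:{0..L}|lborel. (t * (L - t) / 2) * d2 t + w t) = 0" using bc' by simp
    then have \<phi>: "(LINT t:{0..L}|lborel. (t * (L - t) / 2) * d2 t) = - J"
      unfolding J_def LINT_Icc_eq_integral[OF Wc(1), symmetric]
      by (subst (asm) set_integral_add(2)) (auto intro!: borel_integrable_atLeastAtMost' continuous_intros Wc)
    have "continuous_on {0..L} P2" unfolding P2_def by (intro continuous_intros)
    from LINT_f[OF order.refl L0 order.refl deriv2_on_P this]
    have "(LINT t:{0..L}|lborel. P t * f t)
      = (LINT t:{0..L}|lborel. (P2 t - m^2 * P t) * d2 t) + N * J * (LINT t:{0..L}|lborel. P t)"
      using bc' by (simp add: P_def)
    also have "(\<lambda>t. (P2 t - m^2 * P t) * d2 t) = (\<lambda>t. - (m^4 * S) * ((t * (L - t) / 2) * d2 t))"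
      by (auto simp: P2_def P_def fun_eq_iff field_simps eval_nat_numeral)
    also have "(LINT t:{0..L}|lborel. - (m^4 * S) * ((t * (L - t) / 2) * d2 t)) = m^4 * S * J"
      unfolding set_integral_mult_right \<phi> by simp
    finally show ?thesis by (simp add: Q_def algebra_simps)
  qed
  define h where "h = (\<lambda>t. sinh (m * t))"
  define k where "k = (\<lambda>t. sinh (m * (L - t)))"
  have hc: "continuous_on {0..L} h" and kc: "continuous_on {0..L} k"
    unfolding h_def k_def by (auto intro!: continuous_intros)
  have h2: "deriv2_on L h (\<lambda>t. m * cosh (m * t)) (\<lambda>t. m^2 * h t)"
    and k2: "deriv2_on L k (\<lambda>t. - m * cosh (m * (L - t))) (\<lambda>t. m^2 * k t)"
    unfolding deriv2_on_def h_def k_def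
    by (auto intro!: derivative_eq_intros simp: power2_eq_square)
  have x': "0 \<le> x" "x \<le> L" using x by auto
  \<comment> \<open>\<open>h\<close> and \<open>k\<close> are the two branches of the Dirichlet
    kernel; each is tested on its own side of \<open>x\<close>.\<close>
  have H: "(LINT t:{0..x}|lborel. h t * f t) = h x * d3 x - m * cosh (m * x) * d2 x + N * J * ((cosh (m * x) - 1) / m)"
    using LINT_f[OF order.refl x' h2] bc' LINT_sinh(1)[OF x] by (simp add: h_def continuous_intros)
  have K: "(LINT t:{x..L}|lborel. k t * f t) = - k x * d3 x - m * cosh (m * (L - x)) * d2 x + N * J * ((cosh (m * (L - x)) - 1) / m)"
    using LINT_f[OF x' order.refl k2] bc' LINT_sinh(2)[OF x] by (simp add: k_def continuous_intros)
  have sum: "S = k x * cosh (m * x) + h x * cosh (m * (L - x))"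
  proof -
    have "S = sinh (m * x + m * (L - x))" by (simp add: algebra_simps)
    then show ?thesis unfolding sinh_add h_def k_def by simp
  qed
  have Ix: "I x = k x * ((cosh (m * x) - 1) / m) + h x * ((cosh (m * (L - x)) - 1) / m)"
    unfolding I_def sum by (simp add: h_def k_def diff_divide_distrib add_divide_distrib algebra_simps)
  have pos: "0 \<le> (LINT t:{\<alpha>..\<beta>}|lborel. g t * f t)"
    if "0 \<le> \<alpha>" "\<beta> \<le> L" "\<And>t. t \<in> {\<alpha>..\<beta>} \<Longrightarrow> 0 \<le> g t" for g \<alpha> \<beta>
  proof -
    have "AE t in lborel. t \<in> {0..L} \<longrightarrow> 0 \<le> f t"
      using AE_Ioo_imp_AE_Icc[OF ineq] by (simp add: f_def J_def)
    then have "AE t in lborel. 0 \<le> indicator {\<alpha>..\<beta>} t * (g t * f t)"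
      by eventually_elim (use that in \<open>auto simp: indicator_def\<close>)
    then show ?thesis unfolding set_lebesgue_integral_def by (intro integral_nonneg_AE) simp
  qed
  have "0 \<le> (LINT t:{0..x}|lborel. (Q * k x * h t - N * I x * P t) * f t)"
    using kernel_nonneg(1)[of _ x] x by (intro pos) (auto simp: h_def k_def mult.assoc)
  also have "(LINT t:{0..x}|lborel. (Q * k x * h t - N * I x * P t) * f t)
      = Q * k x * (LINT t:{0..x}|lborel. h t * f t) - N * I x * (LINT t:{0..x}|lborel. P t * f t)"
    using x f_int[of 0 x h] f_int[of 0 x P] hc continuous_P
    by (simp add: left_diff_distrib mult.assoc)
  finally have 1: "0 \<le> \<dots>" .
  have "0 \<le> (LINT t:{x..L}|lborel. (Q * h x * k t - N * I x * P t) * f t)"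
    using kernel_nonneg(2)[of x] x by (intro pos) (auto simp: h_def k_def mult.assoc)
  also have "(LINT t:{x..L}|lborel. (Q * h x * k t - N * I x * P t) * f t)
      = Q * h x * (LINT t:{x..L}|lborel. k t * f t) - N * I x * (LINT t:{x..L}|lborel. P t * f t)"
    using x f_int[of x L k] f_int[of x L P] kc continuous_P
    by (simp add: left_diff_distrib mult.assoc)
  finally have 2: "0 \<le> \<dots>" .
  have comb: "(LINT t:{0..x}|lborel. P t * f t) + (LINT t:{x..L}|lborel. P t * f t) = J * Q"
    using LINT_Icc_combine[OF f_int[of 0 L P] x'] continuous_P JQ by simp
  \<comment> \<open>The terms with \<open>d3 x\<close> cancel, the addition formula
    \<open>sum\<close> merges the two coefficients of \<open>d2 x\<close> into \<open>m * S\<close>,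
    and \<open>Ix\<close> merges the terms with \<open>J\<close>.\<close>
  have "Q * m * S * (- d2 x) = Q * k x * (LINT t:{0..x}|lborel. h t * f t) + Q * h x * (LINT t:{x..L}|lborel. k t * f t)
      - N * I x * (J * Q)"
    unfolding H K Ix sum by algebra
  also have "\<dots> \<ge> 0" using 1 2 unfolding comb[symmetric] by (simp add: algebra_simps)
  finally show "d2 x \<le> 0"
    using Q_pos m S_pos L by (simp add: mult_le_0_iff zero_le_mult_iff)
qed

lemma maximum_principle:
  assumes "W41 L w d1 d2 d3 d4" "hinged_bc L w d2"
    and "AE t in lborel. t \<in> {0<..<L} \<longrightarrow> 0 \<le> d4 t - m^2 * d2 t + N * integral {0..L} w"
    and "x \<in> {0..L}"
  shows "0 \<le> w x"
  using concave_vanishing_ends(1)[OF W41_derivs(1)[OF assms(1)] maximum_principle_deriv2[OF assms(1-3)]] assms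
  by (auto simp: hinged_bc_def)

end

section \<open>The linear problem\<close>

text \<open>The second derivative is an argument, not hidden under the quantifier, because the next
  right-hand side of the iteration and the order both refer to it.\<close>

definition lin_sol :: "real \<Rightarrow> real \<Rightarrow> real \<Rightarrow> (real \<Rightarrow> real) \<Rightarrow> (real \<Rightarrow> real) \<Rightarrow> (real \<Rightarrow> real) \<Rightarrow> bool" where
  "lin_sol L M N f w d2 \<longleftrightarrow> (\<exists>d1 d3 d4. W41 L w d1 d2 d3 d4 \<and> hinged_bc L w d2 \<and>
     (AE x in lborel. x \<in> {0<..<L} \<longrightarrow> d4 x - M * d2 x + N * integral {0..L} w = f x))"

lemma integral_diff_continuous:
  fixes u w :: "real \<Rightarrow> real"
  assumes "continuous_on {\<alpha>..\<beta>} u" "continuous_on {\<alpha>..\<beta>} w"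
  shows "integral {\<alpha>..\<beta>} (\<lambda>x. u x - w x) = integral {\<alpha>..\<beta>} u - integral {\<alpha>..\<beta>} w"
  by (intro Henstock_Kurzweil_Integration.integral_diff integrable_continuous_real assms)

lemma lin_sol_continuous:
  assumes "lin_sol L M N f w w2"
  shows "continuous_on {0..L} w" "continuous_on {0..L} w2"
  using assms W41_continuous unfolding lin_sol_def by blast+

lemma lin_sol_deriv2_on:
  assumes "lin_sol L M N f w w2"
  shows "\<exists>w1. deriv2_on L w w1 w2"
  using assms W41_derivs(1) unfolding lin_sol_def by blast

lemma lin_sol_cong_AE:
  assumes "lin_sol L M N f w w2" "AE x in lborel. x \<in> {0<..<L} \<longrightarrow> f x = g x"
  shows "lin_sol L M N g w w2"
proof -
  obtain d1 d3 d4 where d: "W41 L w d1 w2 d3 d4" "hinged_bc L w w2"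
    and eq: "AE x in lborel. x \<in> {0<..<L} \<longrightarrow> d4 x - M * w2 x + N * integral {0..L} w = f x"
    using assms(1) unfolding lin_sol_def by blast
  from eq assms(2) have "AE x in lborel. x \<in> {0<..<L} \<longrightarrow> d4 x - M * w2 x + N * integral {0..L} w = g x"
    by eventually_elim auto
  with d show ?thesis unfolding lin_sol_def by blast
qed

lemma lin_sol_cong_deriv2:
  assumes "lin_sol L M N f w w2" "\<And>x. x \<in> {0..L} \<Longrightarrow> w2 x = e2 x" "0 \<le> L"
  shows "lin_sol L M N f w e2"
proof -
  obtain d1 d3 d4 where d: "W41 L w d1 w2 d3 d4" "hinged_bc L w w2"
    and eq: "AE x in lborel. x \<in> {0<..<L} \<longrightarrow> d4 x - M * w2 x + N * integral {0..L} w = f x"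
    using assms(1) unfolding lin_sol_def by blast
  from eq have "AE x in lborel. x \<in> {0<..<L} \<longrightarrow> d4 x - M * e2 x + N * integral {0..L} w = f x"
    by eventually_elim (use assms(2) in auto)
  moreover have "hinged_bc L w e2" using d(2) assms(2,3) by (auto simp: hinged_bc_def)
  ultimately show ?thesis unfolding lin_sol_def using W41_cong[OF d(1) assms(2)] by blast
qed

lemma lin_sol_diff:
  assumes "lin_sol L M N f u u2" "lin_sol L M N g w w2"
  shows "lin_sol L M N (\<lambda>x. f x - g x) (\<lambda>x. u x - w x) (\<lambda>x. u2 x - w2 x)"
proof -
  obtain u1 u3 u4 where u: "W41 L u u1 u2 u3 u4" "hinged_bc L u u2"
    and ueq: "AE x in lborel. x \<in> {0<..<L} \<longrightarrow> u4 x - M * u2 x + N * integral {0..L} u = f x"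
    using assms(1) unfolding lin_sol_def by blast
  obtain w1 w3 w4 where w: "W41 L w w1 w2 w3 w4" "hinged_bc L w w2"
    and weq: "AE x in lborel. x \<in> {0<..<L} \<longrightarrow> w4 x - M * w2 x + N * integral {0..L} w = g x"
    using assms(2) unfolding lin_sol_def by blast
  have int: "integral {0..L} (\<lambda>x. u x - w x) = integral {0..L} u - integral {0..L} w"
    using W41_continuous(1)[OF u(1)] W41_continuous(1)[OF w(1)] by (rule integral_diff_continuous)
  from ueq weq have "AE x in lborel. x \<in> {0<..<L} \<longrightarrow>
      (u4 x - w4 x) - M * (u2 x - w2 x) + N * integral {0..L} (\<lambda>x. u x - w x) = f x - g x"
    unfolding int by eventually_elim (auto simp: algebra_simps)
  moreover have "hinged_bc L (\<lambda>x. u x - w x) (\<lambda>x. u2 x - w2 x)"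
    using u(2) w(2) by (simp add: hinged_bc_def)
  ultimately show ?thesis
    unfolding lin_sol_def using W41_diff[OF u(1) w(1)] by blast
qed

lemma (in linear_beam) lin_sol_mono:
  assumes u: "lin_sol L (m^2) N f u u2" and w: "lin_sol L (m^2) N g w w2"
    and le: "AE x in lborel. x \<in> {0<..<L} \<longrightarrow> f x \<le> g x" and x: "x \<in> {0..L}"
  shows "u x \<le> w x" "w2 x \<le> u2 x"
proof -
  obtain d1 d3 d4 where d: "W41 L (\<lambda>x. w x - u x) d1 (\<lambda>x. w2 x - u2 x) d3 d4" "hinged_bc L (\<lambda>x. w x - u x) (\<lambda>x. w2 x - u2 x)"
    and eq: "AE x in lborel. x \<in> {0<..<L} \<longrightarrow>
      d4 x - m^2 * (w2 x - u2 x) + N * integral {0..L} (\<lambda>x. w x - u x) = g x - f x"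
    using lin_sol_diff[OF w u] unfolding lin_sol_def by blast
  from eq le have "AE x in lborel. x \<in> {0<..<L} \<longrightarrow>
      0 \<le> d4 x - m^2 * (w2 x - u2 x) + N * integral {0..L} (\<lambda>x. w x - u x)"
    by eventually_elim auto
  from maximum_principle[OF d this x] maximum_principle_deriv2[OF d this x]
  show "u x \<le> w x" "w2 x \<le> u2 x" by auto
qed

text \<open>The second derivative of the solution is sought as the second antiderivative of \<^term>\<open>f\<close>
  plus a correction that solves the equation with a continuous right-hand side.\<close>

lemma exists_local_hinged_solution:
  fixes L m :: real
  assumes L: "0 < L" and m: "0 < m" and f: "set_integrable lborel {0..L} f"
  shows "\<exists>w d1 d2 d3. W41 L w d1 d2 d3 (\<lambda>x. f x + m^2 * d2 x) \<and> hinged_bc L w d2"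
proof -
  define F1 where "F1 = (\<lambda>x. integral {0..x} f)"
  have F1c: "continuous_on {0..L} F1"
    unfolding F1_def using f by (intro indefinite_integral_continuous_1 set_borel_integral_eq_integral(1))
  define F2 where "F2 = (\<lambda>x. integral {0..x} F1)"
  have F2': "(F2 has_real_derivative F1 t) (at t within {0..L})" if "t \<in> {0..L}" for t
    unfolding F2_def by (rule integral_has_real_derivative[OF F1c that])
  have F2c: "continuous_on {0..L} F2"
    by (rule has_real_derivative_Icc_continuous_on[OF F2'])
  \<comment> \<open>Variation of constants for \<open>r'' = m^2 * (r + F2)\<close>: the integral of
    \<open>sinh (m * (x - s)) * F2 s\<close> is split by the addition formula, so that
    \<open>x\<close> leaves the integrand.\<close>
  define A where "A = (\<lambda>x. integral {0..x} (\<lambda>s. cosh (m * s) * F2 s))"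
  define B where "B = (\<lambda>x. integral {0..x} (\<lambda>s. sinh (m * s) * F2 s))"
  have A': "(A has_real_derivative cosh (m * t) * F2 t) (at t within {0..L})" if "t \<in> {0..L}" for t
    unfolding A_def using that
    by (intro integral_has_real_derivative[where g = "\<lambda>s. cosh (m * s) * F2 s"] continuous_intros F2c)
  have B': "(B has_real_derivative sinh (m * t) * F2 t) (at t within {0..L})" if "t \<in> {0..L}" for t
    unfolding B_def using that
    by (intro integral_has_real_derivative[where g = "\<lambda>s. sinh (m * s) * F2 s"] continuous_intros F2c)
  \<comment> \<open>The multiple of the homogeneous solution \<open>sinh (m * x)\<close> that makes
    \<open>d2 L = 0\<close>.\<close>
  define \<kappa> where "\<kappa> = (- F2 L - m * (sinh (m * L) * A L - cosh (m * L) * B L)) / sinh (m * L)"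
  define r where "r = (\<lambda>x. m * (sinh (m * x) * A x - cosh (m * x) * B x) + \<kappa> * sinh (m * x))"
  define r1 where "r1 = (\<lambda>x. m^2 * (cosh (m * x) * A x - sinh (m * x) * B x) + \<kappa> * m * cosh (m * x))"
  have r': "(r has_real_derivative r1 t) (at t within {0..L})" if "t \<in> {0..L}" for t
    unfolding r_def r1_def
    by (rule derivative_eq_intros A'[OF that] B'[OF that] refl | (simp add: algebra_simps power2_eq_square; fail))+
  have r1': "(r1 has_real_derivative m^2 * (r t + F2 t)) (at t within {0..L})" if "t \<in> {0..L}" for t
  proof -
    have "(r1 has_real_derivative m^2 * (m * sinh (m * t) * A t + cosh (m * t) * (cosh (m * t) * F2 t)
        - (m * cosh (m * t) * B t + sinh (m * t) * (sinh (m * t) * F2 t))) + \<kappa> * m * (m * sinh (m * t)))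
        (at t within {0..L})"
      unfolding r1_def
      by (rule derivative_eq_intros A'[OF that] B'[OF that] refl | (simp add: algebra_simps; fail))+
    moreover have "cosh (m * t) * (cosh (m * t) * F2 t) = F2 t + sinh (m * t) * (sinh (m * t) * F2 t)"
      using cosh_square_eq[of "m * t"] by algebra
    ultimately show ?thesis by (simp add: r_def algebra_simps power2_eq_square)
  qed
  define d2 where "d2 = (\<lambda>x. F2 x + r x)"
  define d3 where "d3 = (\<lambda>x. F1 x + r1 x)"
  have d2': "(d2 has_real_derivative d3 t) (at t within {0..L})" if "t \<in> {0..L}" for t
    unfolding d2_def d3_def by (intro derivative_intros F2' r' that)
  have d2c: "continuous_on {0..L} d2" by (rule has_real_derivative_Icc_continuous_on[OF d2'])
  define E where "E = (\<lambda>x. integral {0..x} d2)"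
  have E': "(E has_real_derivative d2 t) (at t within {0..L})" if "t \<in> {0..L}" for t
    unfolding E_def by (rule integral_has_real_derivative[OF d2c that])
  have Ec: "continuous_on {0..L} E" by (rule has_real_derivative_Icc_continuous_on[OF E'])
  define G where "G = (\<lambda>x. integral {0..x} E)"
  have G': "(G has_real_derivative E t) (at t within {0..L})" if "t \<in> {0..L}" for t
    unfolding G_def by (rule integral_has_real_derivative[OF Ec that])
  define w where "w = (\<lambda>x. G x - G L / L * x)"
  define d1 where "d1 = (\<lambda>x. E x - G L / L)"
  have w': "(w has_real_derivative d1 t) (at t within {0..L})" if "t \<in> {0..L}" for t
    unfolding w_def d1_def by (rule derivative_eq_intros G'[OF that] refl | simp)+
  have d1': "(d1 has_real_derivative d2 t) (at t within {0..L})" if "t \<in> {0..L}" for t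
    unfolding d1_def by (rule derivative_eq_intros E'[OF that] refl | simp)+
  have i4: "set_integrable lborel {0..L} (\<lambda>x. f x + m^2 * d2 x)"
    by (intro set_integral_add f borel_integrable_atLeastAtMost' continuous_intros d2c)
  have d3_eq: "d3 t = d3 0 + (LINT s:{0..t}|lborel. f s + m^2 * d2 s)" if t: "t \<in> {0..L}" for t
  proof -
    have ft: "set_integrable lborel {0..t} f"
      by (rule set_integrable_subset[OF f]) (use t in auto)
    have d2t: "continuous_on {0..t} d2"
      by (rule continuous_on_subset[OF d2c]) (use t in auto)
    have "(LINT s:{0..t}|lborel. m^2 * d2 s) = r1 t - r1 0"
    proof (rule LINT_Icc_FTC[where \<alpha> = 0 and \<beta> = L])
      show "(r1 has_real_derivative m^2 * d2 s) (at s within {0..L})" if "s \<in> {0..L}" for s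
        using r1'[OF that] by (simp add: d2_def add.commute)
    qed (use t in \<open>auto intro!: continuous_intros d2c\<close>)
    moreover have "(LINT s:{0..t}|lborel. f s + m^2 * d2 s)
        = (LINT s:{0..t}|lborel. f s) + (LINT s:{0..t}|lborel. m^2 * d2 s)"
      by (intro set_integral_add ft borel_integrable_atLeastAtMost' continuous_intros d2t)
    moreover have "(LINT s:{0..t}|lborel. f s) = F1 t"
      using set_borel_integral_eq_integral(2)[OF ft] by (simp add: F1_def)
    moreover have "F1 0 = 0" by (simp add: F1_def)
    ultimately show ?thesis by (simp add: d3_def)
  qed
  have "hinged_bc L w d2"
    using L m by (auto simp: hinged_bc_def w_def d2_def r_def G_def F2_def A_def B_def \<kappa>_def)
  with w' d1' d2' i4 d3_eq show ?thesis
    unfolding W41_def deriv2_on_def by blast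
qed

text \<open>The nonlocal term is a constant, so the solution for \<open>N = 0\<close> is corrected
  by a multiple of the response \<open>e\<close> to the constant 1. The factor \<kappa> solves the
  scalar equation \<open>\<kappa> = N * \<integral>(u - \<kappa> * e)\<close>.\<close>

lemma (in linear_beam) exists_lin_sol:
  assumes f: "set_integrable lborel {0..L} f"
  shows "\<exists>w w2. lin_sol L (m^2) N f w w2"
proof -
  obtain u u1 u2 u3 where u: "W41 L u u1 u2 u3 (\<lambda>x. f x + m^2 * u2 x)" "hinged_bc L u u2"
    using exists_local_hinged_solution[OF L m f] by blast
  have "set_integrable lborel {0..L} (\<lambda>_. 1 :: real)"
    by (intro borel_integrable_atLeastAtMost' continuous_intros)
  then obtain e e1 e2 e3 where e: "W41 L e e1 e2 e3 (\<lambda>x. 1 + m^2 * e2 x)" "hinged_bc L e e2"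
    using exists_local_hinged_solution[OF L m] by blast
  \<comment> \<open>For \<open>N = 0\<close> the condition \<open>N_le\<close> is trivial; the
    resulting sign of \<open>e\<close> keeps the denominator of \<kappa> positive.\<close>
  have "linear_beam L m 0" using L m by unfold_locales auto
  from linear_beam.maximum_principle[OF this e] have "0 \<le> e x" if "x \<in> {0..L}" for x
    using that by simp
  then have e_int: "0 \<le> integral {0..L} e"
    by (intro Henstock_Kurzweil_Integration.integral_nonneg integrable_continuous_real W41_continuous(1)[OF e(1)])
  define \<kappa> where "\<kappa> = N * integral {0..L} u / (1 + N * integral {0..L} e)"
  have den: "0 < 1 + N * integral {0..L} e" using e_int N by (simp add: add_pos_nonneg)
  let ?w = "\<lambda>x. u x - \<kappa> * e x"
  note W = W41_diff[OF u(1) W41_cmult[OF e(1), of \<kappa>]]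
  have "integral {0..L} ?w = integral {0..L} u - \<kappa> * integral {0..L} e"
    by (subst integral_diff_continuous) (auto intro!: continuous_intros W41_continuous(1)[OF u(1)] W41_continuous(1)[OF e(1)])
  moreover have "N * (integral {0..L} u - \<kappa> * integral {0..L} e) = \<kappa>"
    using den unfolding \<kappa>_def by (simp add: field_simps)
  ultimately have "N * integral {0..L} ?w = \<kappa>" by simp
  then have "(f x + m^2 * u2 x - \<kappa> * (1 + m^2 * e2 x)) - m^2 * (u2 x - \<kappa> * e2 x) + N * integral {0..L} ?w = f x" for x
    by (simp add: algebra_simps)
  moreover have "hinged_bc L ?w (\<lambda>x. u2 x - \<kappa> * e2 x)"
    using u(2) e(2) by (simp add: hinged_bc_def)
  ultimately show ?thesis unfolding lin_sol_def using W by fastforce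
qed

section \<open>Pointwise and integral bounds for concave solutions\<close>

lemma concave_interior_zero:
  assumes w: "deriv2_on L w d1 d2" and d2: "\<And>x. x \<in> {0..L} \<Longrightarrow> d2 x \<le> 0"
    and w0: "\<And>x. x \<in> {0..L} \<Longrightarrow> 0 \<le> w x" and r: "r \<in> {0<..<L}" "w r = 0" and x: "x \<in> {0..L}"
  shows "w x = 0"
proof -
  have w': "\<And>t. t \<in> {0..L} \<Longrightarrow> (w has_real_derivative d1 t) (at t within {0..L})"
    using w unfolding deriv2_on_def by auto
  \<comment> \<open>The interior minimum \<open>r\<close> has slope 0, and since slopes decrease,
    \<open>w\<close> cannot rise when moving away from \<open>r\<close> in either direction.\<close>
  have "at r within {0..L} = at r"
    using r by (intro at_within_interior) auto
  then have "(w has_real_derivative d1 r) (at r)" using w'[of r] r by auto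
  then have d1r: "d1 r = 0"
  proof (rule DERIV_local_min)
    show "0 < min r (L - r)" using r by auto
    show "\<forall>y. \<bar>r - y\<bar> < min r (L - r) \<longrightarrow> w r \<le> w y"
      using r w0 by (auto simp: abs_if split: if_splits)
  qed
  have "w x \<le> 0"
  proof (cases x r rule: linorder_cases)
    case less
    then obtain \<xi> where \<xi>: "\<xi> \<in> {x<..<r}" "w r - w x = (r - x) * d1 \<xi>"
      using mvt_Icc[of 0 L w d1 x r, OF w'] x r by force
    have "0 \<le> d1 \<xi>" using deriv2_on_antimono[OF w d2, of \<xi> r] \<xi> r x d1r by auto
    then have "0 \<le> (r - x) * d1 \<xi>" using less by simp
    then show ?thesis using \<xi> r by simp
  next
    case greater
    then obtain \<xi> where \<xi>: "\<xi> \<in> {r<..<x}" "w x - w r = (x - r) * d1 \<xi>"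
      using mvt_Icc[of 0 L w d1 r x, OF w'] x r by force
    have "d1 \<xi> \<le> 0" using deriv2_on_antimono[OF w d2, of r \<xi>] \<xi> r x d1r by auto
    then have "(x - r) * d1 \<xi> \<le> 0" using greater by (intro mult_nonneg_nonpos) auto
    then show ?thesis using \<xi> r by simp
  qed (use r in simp)
  with w0[OF x] show ?thesis by simp
qed

text \<open>Comparison with the parabola \<open>\<delta> * (x * (L - x) / 2)\<close>: its difference
  from \<open>w\<close> is concave and vanishes at both ends.\<close>

lemma le_of_deriv2_ge:
  assumes w: "deriv2_on L w d1 d2" and d2: "\<And>x. x \<in> {0..L} \<Longrightarrow> - \<delta> \<le> d2 x"
    and "w 0 = 0" "w L = 0" and x: "x \<in> {0..L}" and "0 \<le> \<delta>"
  shows "w x \<le> \<delta> * L^2"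
proof -
  have "deriv2_on L (\<lambda>x. \<delta> * (x * (L - x) / 2)) (\<lambda>x. \<delta> * (L / 2 - x)) (\<lambda>x. - \<delta>)"
    unfolding deriv2_on_def by (auto intro!: derivative_eq_intros simp: field_simps)
  from concave_vanishing_ends(1)[OF deriv2_on_diff[OF this w] _ _ _ x]
  have "0 \<le> \<delta> * (x * (L - x) / 2) - w x" using assms by fastforce
  moreover have "x * (L - x) / 2 \<le> L^2"
  proof -
    have "x * (L - x) \<le> L * L" using x by (intro mult_mono) auto
    moreover have "0 \<le> L * L" by simp
    ultimately show ?thesis unfolding power2_eq_square by linarith
  qed
  then have "\<delta> * (x * (L - x) / 2) \<le> \<delta> * L^2" using \<open>0 \<le> \<delta>\<close> by (rule mult_left_mono)
  ultimately show ?thesis by simp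
qed

text \<open>Integrating the equation over the whole interval costs nothing for the fourth-order term,
  since the second derivative has its maximum at both ends.\<close>

lemma lin_sol_energy_le:
  assumes L: "0 < L" and w: "lin_sol L M N g w w2" and g: "set_integrable lborel {0..L} g"
    and w2: "\<And>x. x \<in> {0..L} \<Longrightarrow> w2 x \<le> 0"
  shows "M * (- integral {0..L} w2) + N * L * integral {0..L} w \<le> (LINT t:{0..L}|lborel. g t)"
proof -
  obtain d1 d3 d4 where d: "W41 L w d1 w2 d3 d4" "hinged_bc L w w2"
    and eq: "AE x in lborel. x \<in> {0<..<L} \<longrightarrow> d4 x - M * w2 x + N * integral {0..L} w = g x"
    using w unfolding lin_sol_def by blast
  note W = W41_derivs[OF d(1)] and Wc = W41_continuous[OF d(1)]
  have bc: "w2 0 = 0" "w2 L = 0" using d(2) by (auto simp: hinged_bc_def)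
  have "d3 0 \<le> 0"
  proof (rule ccontr)
    assume "\<not> d3 0 \<le> 0"
    then obtain e where e: "0 < e" "\<And>h. 0 < h \<Longrightarrow> 0 + h \<in> {0..L} \<Longrightarrow> h < e \<Longrightarrow> w2 0 < w2 (0 + h)"
      using has_real_derivative_pos_inc_right[OF W(4)[of 0]] L by force
    obtain h where "0 < h" "h < e" "h < L" using dense[of 0 "min e L"] e(1) L by auto
    then show False using e(2)[of h] w2[of h] bc by auto
  qed
  moreover have "0 \<le> d3 L"
  proof (rule ccontr)
    assume "\<not> 0 \<le> d3 L"
    then obtain e where e: "0 < e" "\<And>h. 0 < h \<Longrightarrow> L - h \<in> {0..L} \<Longrightarrow> h < e \<Longrightarrow> w2 L < w2 (L - h)"
      using has_real_derivative_neg_dec_left[OF W(4)[of L]] L by force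
    obtain h where "0 < h" "h < e" "h < L" using dense[of 0 "min e L"] e(1) L by auto
    then show False using e(2)[of h] w2[of "L - h"] bc by auto
  qed
  ultimately have "0 \<le> (LINT t:{0..L}|lborel. d4 t)" using W(6)[of L] L by simp
  moreover have "(LINT t:{0..L}|lborel. d4 t - M * w2 t + N * integral {0..L} w)
      = (LINT t:{0..L}|lborel. d4 t) - M * integral {0..L} w2 + N * L * integral {0..L} w"
  proof -
    have c: "set_integrable lborel {0..L} (\<lambda>t. M * w2 t)" "set_integrable lborel {0..L} (\<lambda>t. N * integral {0..L} w)"
      by (intro borel_integrable_atLeastAtMost' continuous_intros Wc)+
    have "(LINT t:{0..L}|lborel. N * integral {0..L} w) = N * L * integral {0..L} w"
      using L by (subst LINT_Icc_eq_integral) (auto intro!: continuous_intros)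
    then show ?thesis
      using c W(5) LINT_Icc_eq_integral[OF Wc(3)] by simp
  qed
  moreover have "(LINT t:{0..L}|lborel. d4 t - M * w2 t + N * integral {0..L} w) \<le> (LINT t:{0..L}|lborel. g t)"
  proof (rule set_integral_mono_AE[OF _ g])
    show "set_integrable lborel {0..L} (\<lambda>t. d4 t - M * w2 t + N * integral {0..L} w)"
      by (intro set_integral_add set_integral_diff W(5)) (intro borel_integrable_atLeastAtMost' continuous_intros Wc)+
    show "AE t\<in>{0..L} in lborel. d4 t - M * w2 t + N * integral {0..L} w \<le> g t"
      using AE_Ioo_imp_AE_Icc[OF eq] by eventually_elim auto
  qed
  ultimately show ?thesis by simp
qed

text \<open>By the signs of \<open>w\<close> and \<open>w2\<close>, \<open>d4 \<le> g\<close> almost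
  everywhere. Left of \<open>x\<close> the slope \<open>d3\<close> is somewhere nonpositive, right
  of \<open>x\<close> it somewhere equals \<open>- w2 x / (L - x)\<close>, and in between it rises
  by at most the integral of \<open>g\<close>.\<close>

lemma lin_sol_deriv2_bound:
  assumes L: "0 < L" and M: "0 \<le> M" and N: "0 \<le> N"
    and w: "lin_sol L M N g w w2" and g: "set_integrable lborel {0..L} g"
    and g0: "AE x in lborel. x \<in> {0<..<L} \<longrightarrow> 0 \<le> g x"
    and w2: "\<And>x. x \<in> {0..L} \<Longrightarrow> w2 x \<le> 0" and w0: "\<And>x. x \<in> {0..L} \<Longrightarrow> 0 \<le> w x"
    and x: "x \<in> {0..L}"
  shows "- w2 x \<le> L * (LINT t:{0..L}|lborel. g t)"
proof -
  obtain d1 d3 d4 where d: "W41 L w d1 w2 d3 d4" "hinged_bc L w w2"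
    and eq: "AE x in lborel. x \<in> {0<..<L} \<longrightarrow> d4 x - M * w2 x + N * integral {0..L} w = g x"
    using w unfolding lin_sol_def by blast
  note W = W41_derivs[OF d(1)] and Wc = W41_continuous[OF d(1)]
  have bc: "w2 0 = 0" "w2 L = 0" using d(2) by (auto simp: hinged_bc_def)
  have J0: "0 \<le> integral {0..L} w"
    using w0 by (intro Henstock_Kurzweil_Integration.integral_nonneg integrable_continuous_real Wc)
  have le: "AE t in lborel. t \<in> {0..L} \<longrightarrow> d4 t \<le> g t"
    using AE_Ioo_imp_AE_Icc[OF eq]
  proof eventually_elim
    case (elim t)
    show ?case
    proof
      assume t: "t \<in> {0..L}"
      have "M * w2 t \<le> 0" using M w2[OF t] by (rule mult_nonneg_nonpos)
      moreover have "0 \<le> N * integral {0..L} w" using N J0 by simp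
      ultimately show "d4 t \<le> g t" using elim t by auto
    qed
  qed
  have g0': "AE t in lborel. t \<in> {0..L} \<longrightarrow> 0 \<le> g t" by (rule AE_Ioo_imp_AE_Icc[OF g0])
  have G0: "0 \<le> (LINT t:{0..L}|lborel. g t)"
    unfolding set_lebesgue_integral_def
    by (intro integral_nonneg_AE) (use g0' in \<open>eventually_elim; auto simp: indicator_def\<close>)
  show ?thesis
  proof (cases "w2 x = 0")
    case True
    then show ?thesis using G0 L by simp
  next
    case False
    then have x': "0 < x" "x < L" using x bc by (auto simp: less_le)
    obtain \<xi> where \<xi>: "\<xi> \<in> {0<..<x}" "w2 x - w2 0 = (x - 0) * d3 \<xi>"
      using mvt_Icc[of 0 L w2 d3 0 x, OF W(4)] x' by force
    obtain \<eta> where \<eta>: "\<eta> \<in> {x<..<L}" "w2 L - w2 x = (L - x) * d3 \<eta>"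
      using mvt_Icc[of 0 L w2 d3 x L, OF W(4)] x' by force
    have "x * d3 \<xi> \<le> 0" using \<xi>(2) bc w2[OF x] by simp
    then have "d3 \<xi> \<le> 0" using x' by (simp add: mult_le_0_iff)
    have sub: "{\<xi>..\<eta>} \<subseteq> {0..L}" using \<xi> \<eta> by auto
    have i4: "set_integrable lborel {0..\<eta>} d4"
      by (rule set_integrable_subset[OF W(5)]) (use \<eta> x' in auto)
    have "d3 \<eta> - d3 \<xi> = (LINT t:{\<xi>..\<eta>}|lborel. d4 t)"
      using LINT_Icc_combine[OF i4, of \<xi>] W(6)[of \<xi>] W(6)[of \<eta>] \<xi> \<eta> x' by simp
    also have "\<dots> \<le> (LINT t:{0..L}|lborel. g t)"
      unfolding set_lebesgue_integral_def
    proof (rule integral_mono_AE)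
      show "integrable lborel (\<lambda>t. indicator {\<xi>..\<eta>} t *\<^sub>R d4 t)"
        using set_integrable_subset[OF W(5), of "{\<xi>..\<eta>}"] sub unfolding set_integrable_def by simp
      show "integrable lborel (\<lambda>t. indicator {0..L} t *\<^sub>R g t)"
        using g unfolding set_integrable_def .
      show "AE t in lborel. indicator {\<xi>..\<eta>} t *\<^sub>R d4 t \<le> indicator {0..L} t *\<^sub>R g t"
        using le g0' by eventually_elim (use sub in \<open>auto simp: indicator_def\<close>)
    qed
    finally have "d3 \<eta> \<le> (LINT t:{0..L}|lborel. g t)" using \<open>d3 \<xi> \<le> 0\<close> by simp
    then have "(L - x) * d3 \<eta> \<le> (L - x) * (LINT t:{0..L}|lborel. g t)"
      using x' by (intro mult_left_mono) auto
    also have "\<dots> \<le> L * (LINT t:{0..L}|lborel. g t)"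
      using x' G0 by (intro mult_right_mono) auto
    finally show ?thesis using \<eta>(2) bc by simp
  qed
qed

section \<open>The monotone iteration\<close>

lemma W41_sine:
  "W41 L (\<lambda>x. r * sin (\<omega> * x)) (\<lambda>x. r * \<omega> * cos (\<omega> * x)) (\<lambda>x. - r * \<omega>^2 * sin (\<omega> * x))
    (\<lambda>x. - r * \<omega>^3 * cos (\<omega> * x)) (\<lambda>x. r * \<omega>^4 * sin (\<omega> * x))"
proof -
  have d3: "- r * \<omega>^3 * cos (\<omega> * t) = - r * \<omega>^3 * cos (\<omega> * 0) + (LINT s:{0..t}|lborel. r * \<omega>^4 * sin (\<omega> * s))"
    if "t \<in> {0..L}" for t
  proof -
    have "(LINT s:{0..t}|lborel. r * \<omega>^4 * sin (\<omega> * s)) = - r * \<omega>^3 * cos (\<omega> * t) - - r * \<omega>^3 * cos (\<omega> * 0)"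
      by (rule LINT_Icc_FTC[where \<alpha> = 0 and \<beta> = L])
        (use that in \<open>auto intro!: derivative_eq_intros continuous_intros simp: eval_nat_numeral\<close>)
    then show ?thesis by simp
  qed
  show ?thesis
    unfolding W41_def deriv2_on_def
  proof (intro conjI ballI)
    show "set_integrable lborel {0..L} (\<lambda>x. r * \<omega>^4 * sin (\<omega> * x))"
      by (intro borel_integrable_atLeastAtMost' continuous_intros)
    show "- r * \<omega>^3 * cos (\<omega> * t) = - r * \<omega>^3 * cos (\<omega> * 0) + (LINT s:{0..t}|lborel. r * \<omega>^4 * sin (\<omega> * s))"
      if "t \<in> {0..L}" for t by (rule d3[OF that])
  qed (auto intro!: derivative_eq_intros simp: power2_eq_square power3_eq_cube)
qed

lemma hinged_sine: "0 < L \<Longrightarrow> hinged_bc L (\<lambda>x. r * sin (pi / L * x)) (\<lambda>x. s * sin (pi / L * x))"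
  by (simp add: hinged_bc_def)

lemma integral_sine:
  assumes "0 < L"
  shows "integral {0..L} (\<lambda>x. r * sin (pi / L * x)) = 2 * r * L / pi"
proof -
  have "((\<lambda>x. r * sin (pi / L * x)) has_integral
      (- r * L / pi * cos (pi / L * L) - - r * L / pi * cos (pi / L * 0))) {0..L}"
    using assms
    by (intro fundamental_theorem_of_calculus)
      (auto intro!: derivative_eq_intros simp: has_real_derivative_iff_has_vector_derivative[symmetric])
  then show ?thesis using assms by (auto dest!: integral_unique simp: field_simps)
qed

lemma uniform_limit_of_gap:
  fixes y :: "nat \<Rightarrow> real \<Rightarrow> real"
  assumes "\<epsilon> \<longlonglongrightarrow> 0" "\<And>k x. x \<in> S \<Longrightarrow> \<bar>y (Suc k) x - u x\<bar> \<le> \<epsilon> k"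
  shows "uniform_limit S y u sequentially"
proof (rule uniform_limitI)
  fix r :: real assume "0 < r"
  with assms(1) have "\<forall>\<^sub>F k in sequentially. \<epsilon> k < r" by (rule order_tendstoD(2))
  then have "\<forall>\<^sub>F k in sequentially. \<forall>x\<in>S. dist (y (Suc k) x) (u x) < r"
  proof eventually_elim
    case (elim k)
    show ?case
    proof
      fix x assume "x \<in> S"
      from assms(2)[OF this, of k] elim show "dist (y (Suc k) x) (u x) < r" by (simp add: dist_real_def)
    qed
  qed
  then show "\<forall>\<^sub>F k in sequentially. \<forall>x\<in>S. dist (y k x) (u x) < r"
    by (simp add: eventually_sequentially_Suc[of "\<lambda>k. \<forall>x\<in>S. dist (y k x) (u x) < r"])
qed

section \<open>The right-hand side of the iteration on the sector\<close>

locale beam =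
  fixes L EI a b c lam :: real and p :: "real \<Rightarrow> real"
  assumes L: "0 < L" and EI: "0 < EI" and a: "0 < a" and b: "0 < b" and c: "0 < c" and lam: "0 < lam"
    and p_int: "set_integrable lborel {0..L} p"
    and p_nonneg: "AE x in lborel. x \<in> {0<..<L} \<longrightarrow> p x \<ge> 0"
    and p_bound: "AE x in lborel. x \<in> {0<..<L} \<longrightarrow>
      p x / EI \<le> (lam * pi^4 / L^4 + a * lam * pi^2 / L^2 + 2 * b * lam^2 * pi / L)
                     * sin (pi / L * x) + 2 * lam * c * L / pi"
    and linear: "linear_beam L (sqrt (a + 2 * b * lam * L / pi)) (c + b * lam * pi^2 / L^2)"
begin

definition "M = a + 2 * b * lam * L / pi"
definition "N = c + b * lam * pi^2 / L^2"
definition "B = 2 * lam * L / pi"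
definition "K = lam * (pi / L)^2"

definition \<beta> :: "real \<Rightarrow> real" where "\<beta> x = lam * sin (pi / L * x)"
definition \<beta>2 :: "real \<Rightarrow> real" where "\<beta>2 x = - lam * (pi / L)^2 * sin (pi / L * x)"

abbreviation mass :: "(real \<Rightarrow> real) \<Rightarrow> real" where "mass u \<equiv> integral {0..L} u"
abbreviation "T \<equiv> lin_sol L M N"

definition F :: "real \<Rightarrow> (real \<Rightarrow> real) \<Rightarrow> real \<Rightarrow> real" where
  "F J e x = p x / EI + b * (e x * J - B * e x + K * J)"

definition le2 :: "(real \<Rightarrow> real) \<Rightarrow> (real \<Rightarrow> real) \<Rightarrow> (real \<Rightarrow> real) \<Rightarrow> (real \<Rightarrow> real) \<Rightarrow> bool" where
  "le2 u u2 w w2 \<longleftrightarrow> (\<forall>x\<in>{0..L}. u x \<le> w x \<and> w2 x \<le> u2 x)"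

text \<open>That \<open>u2\<close> is the second derivative of \<open>u\<close> is not demanded
  here; \<open>T\<close> supplies it. Signs, bounds and continuity are what the estimates of
  \<open>F\<close> and \<open>mass\<close> use.\<close>

definition sect :: "(real \<Rightarrow> real) \<Rightarrow> (real \<Rightarrow> real) \<Rightarrow> bool" where
  "sect u u2 \<longleftrightarrow> continuous_on {0..L} u \<and> continuous_on {0..L} u2 \<and>
     le2 (\<lambda>_. 0) (\<lambda>_. 0) u u2 \<and> le2 u u2 \<beta> \<beta>2"

lemma M_eq: "M = a + b * B" and N_eq: "N = c + b * K"
  by (simp_all add: M_def N_def B_def K_def power_divide)

lemma B_pos: "0 < B" and K_pos: "0 < K"
  using L lam by (simp_all add: B_def K_def)

lemma M_pos: "0 < M" and N_pos: "0 < N"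
  using a b c B_pos K_pos by (simp_all add: M_eq N_eq add_pos_pos)

lemma T_mono:
  assumes "T f u u2" "T g w w2" "AE x in lborel. x \<in> {0<..<L} \<longrightarrow> f x \<le> g x"
  shows "le2 u u2 w w2"
proof -
  interpret lin: linear_beam L "sqrt M" N using linear by (simp add: M_def N_def)
  have sq: "(sqrt M)^2 = M" using M_pos by simp
  show ?thesis
    unfolding le2_def using assms lin.lin_sol_mono[unfolded sq] by blast
qed

lemma T_exists:
  assumes "set_integrable lborel {0..L} f"
  shows "\<exists>w w2. T f w w2"
proof -
  interpret lin: linear_beam L "sqrt M" N using linear by (simp add: M_def N_def)
  have sq: "(sqrt M)^2 = M" using M_pos by simp
  show ?thesis using lin.exists_lin_sol[OF assms, unfolded sq] .
qed

lemma F_integrable: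
  assumes "continuous_on {0..L} e"
  shows "set_integrable lborel {0..L} (F J e)"
  unfolding F_def using assms p_int
  by (intro set_integral_add set_integrable_divide) (auto intro!: borel_integrable_atLeastAtMost' continuous_intros)

lemma F_mono:
  assumes "J1 \<le> J2" "J2 \<le> B" "e2 x \<le> e1 x" "- K \<le> e1 x"
  shows "F J1 e1 x \<le> F J2 e2 x"
proof -
  have "0 \<le> b * ((B - J2) * (e1 x - e2 x) + (J2 - J1) * (e1 x + K))"
    using assms b by simp
  then show ?thesis by (simp add: F_def algebra_simps)
qed

text \<open>The discarded bilinear remainder has a favourable sign on the sector. What is left is
  linear in the two gaps and integrates to a quantity comparable with the energy.\<close>

lemma F_diff_le:
  assumes "0 \<le> J2" "J1 \<le> J2" "e2 x \<le> e1 x" "e1 x \<le> 0"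
  shows "F J2 e2 x - F J1 e1 x \<le> b * (B * (e1 x - e2 x) + K * (J2 - J1))"
proof -
  have "0 \<le> b * (J2 * (e1 x - e2 x) + (J2 - J1) * (- e1 x))"
    using assms b by (intro mult_nonneg_nonneg add_nonneg_nonneg) auto
  then show ?thesis by (simp add: F_def algebra_simps)
qed

lemma sine_bounds:
  assumes "x \<in> {0..L}" shows "0 \<le> sin (pi / L * x)" "sin (pi / L * x) \<le> 1"
proof -
  have "pi * x \<le> pi * L" using assms by simp
  then show "0 \<le> sin (pi / L * x)"
    using assms L by (intro sin_ge_zero) (auto simp: field_simps)
qed simp

lemma W41_beta: "W41 L \<beta> (\<lambda>x. lam * (pi / L) * cos (pi / L * x)) \<beta>2
    (\<lambda>x. - lam * (pi / L)^3 * cos (pi / L * x)) (\<lambda>x. lam * (pi / L)^4 * sin (pi / L * x))"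
  unfolding \<beta>_def \<beta>2_def by (rule W41_sine)

lemma mass_beta: "mass \<beta> = B"
  using integral_sine[OF L, of lam] by (simp add: \<beta>_def[abs_def] B_def)

lemma sect_zero: "sect (\<lambda>_. 0) (\<lambda>_. 0)" and sect_beta: "sect \<beta> \<beta>2"
  using sine_bounds lam W41_continuous(1,3)[OF W41_beta]
  by (auto simp: sect_def le2_def \<beta>_def \<beta>2_def mult_nonneg_nonpos)

lemma mass_mono:
  assumes "continuous_on {0..L} u" "continuous_on {0..L} w" "le2 u u2 w w2"
  shows "mass u \<le> mass w"
  using assms by (intro integral_le integrable_continuous_real) (auto simp: le2_def)

lemma sect_mass:
  assumes "sect u u2" shows "0 \<le> mass u" "mass u \<le> B"
  using mass_mono[of "\<lambda>_. 0" u] mass_mono[of u \<beta>] assms sect_beta mass_beta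
  by (auto simp: sect_def)

lemma beta2_ge: "x \<in> {0..L} \<Longrightarrow> - K \<le> \<beta>2 x"
  using sine_bounds[of x] lam mult_left_mono[of "sin (pi / L * x)" 1 "lam * (pi / L)^2"]
  by (simp add: \<beta>2_def K_def)

lemma sect_deriv2:
  assumes "sect u u2" "x \<in> {0..L}" shows "- K \<le> u2 x" "u2 x \<le> 0"
  using assms beta2_ge[of x] by (auto simp: sect_def le2_def intro: order_trans)

lemma F_mono_sect:
  assumes "sect u u2" "sect w w2" "le2 u u2 w w2" "x \<in> {0..L}"
  shows "F (mass u) u2 x \<le> F (mass w) w2 x"
proof (rule F_mono)
  show "mass u \<le> mass w" using assms mass_mono unfolding sect_def by blast
  show "mass w \<le> B" by (rule sect_mass[OF assms(2)])
  show "w2 x \<le> u2 x" using assms by (simp add: le2_def)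
  show "- K \<le> u2 x" by (rule sect_deriv2[OF assms(1,4)])
qed

lemma step_le2:
  assumes "sect u u2" "sect w w2" "le2 u u2 w w2"
    and "T (F (mass u) u2) U U2" "T (F (mass w) w2) W W2"
  shows "le2 U U2 W W2"
  using assms(4,5) by (rule T_mono) (use F_mono_sect[OF assms(1-3)] in auto)

lemma T_zero: "T (\<lambda>_. 0) (\<lambda>_. 0) (\<lambda>_. 0)"
proof -
  have "W41 L (\<lambda>_. 0) (\<lambda>_. 0) (\<lambda>_. 0) (\<lambda>_. 0) (\<lambda>_. 0)"
    by (simp add: W41_def deriv2_on_def set_integrable_def)
  then show ?thesis unfolding lin_sol_def hinged_bc_def by fastforce
qed

text \<open>Monotonicity reduces the claim to the two ends of the sector. At 0 the right-hand side
  is \<open>p / EI\<close>. At \<beta> the terms in \<open>e\<close> cancel because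
  \<open>mass \<beta> = B\<close>, leaving \<open>p / EI + b * K * B\<close>, and the bound on
  \<open>p\<close> places this below the linear operator applied to \<beta>.\<close>

lemma step_sect:
  assumes u: "sect u u2" and U: "T (F (mass u) u2) U U2"
  shows "sect U U2"
proof -
  have "le2 (\<lambda>_. 0) (\<lambda>_. 0) U U2"
  proof (rule T_mono[OF T_zero U])
    have le: "F 0 (\<lambda>_. 0) x \<le> F (mass u) u2 x" if "x \<in> {0..L}" for x
      using F_mono_sect[OF sect_zero u _ that] u by (simp add: sect_def)
    from p_nonneg show "AE x in lborel. x \<in> {0<..<L} \<longrightarrow> 0 \<le> F (mass u) u2 x"
    proof eventually_elim
      case (elim x)
      show ?case
      proof
        assume x: "x \<in> {0<..<L}"
        then have "0 \<le> F 0 (\<lambda>_. 0) x" using elim EI by (simp add: F_def)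
        also have "\<dots> \<le> F (mass u) u2 x" using x by (intro le) auto
        finally show "0 \<le> F (mass u) u2 x" .
      qed
    qed
  qed
  moreover have "le2 U U2 \<beta> \<beta>2"
  proof (rule T_mono[OF U])
    let ?g = "\<lambda>x. lam * (pi / L)^4 * sin (pi / L * x) - M * \<beta>2 x + N * mass \<beta>"
    have "hinged_bc L \<beta> \<beta>2" unfolding \<beta>_def \<beta>2_def by (rule hinged_sine[OF L])
    then show "T ?g \<beta> \<beta>2" unfolding lin_sol_def using W41_beta by fastforce
    have le: "F (mass u) u2 x \<le> F B \<beta>2 x" if "x \<in> {0..L}" for x
      using F_mono_sect[OF u sect_beta _ that] u mass_beta by (simp add: sect_def)
    from p_bound show "AE x in lborel. x \<in> {0<..<L} \<longrightarrow> F (mass u) u2 x \<le> ?g x"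
    proof eventually_elim
      case (elim x)
      show ?case
      proof
        assume x: "x \<in> {0<..<L}"
        have "F (mass u) u2 x \<le> F B \<beta>2 x" using x by (intro le) auto
        also have "\<dots> = p x / EI + b * K * B" by (simp add: F_def)
        also have "\<dots> \<le> ?g x"
        proof -
          have "?g x = (lam * pi^4 / L^4 + a * lam * pi^2 / L^2 + 2 * b * lam^2 * pi / L) * sin (pi / L * x)
              + 2 * lam * c * L / pi + b * K * B"
            unfolding mass_beta \<beta>2_def M_eq N_eq B_def K_def using L
            by (simp add: field_simps power2_eq_square eval_nat_numeral)
          then show ?thesis using elim x by simp
        qed
        finally show "F (mass u) u2 x \<le> ?g x" .
      qed
    qed
  qed
  ultimately show ?thesis using lin_sol_continuous[OF U] by (simp add: sect_def)
qed

section \<open>Contraction of the energy\<close>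

definition "q = max (b * B / M) (b * K / N)"

lemma q_bounds: "0 \<le> q" "q < 1" "b * B \<le> q * M" "b * K \<le> q * N"
proof -
  show "0 \<le> q" "q < 1" using b B_pos K_pos M_pos N_pos a c
    by (auto simp: q_def M_eq N_eq le_max_iff_disj)
  have "b * B = b * B / M * M" "b * K = b * K / N * N" using M_pos N_pos by simp_all
  then show "b * B \<le> q * M" "b * K \<le> q * N"
    using M_pos N_pos by (metis mult_right_mono less_imp_le max.cobounded1 q_def)
      (metis \<open>b * K = b * K / N * N\<close> N_pos mult_right_mono less_imp_le max.cobounded2 q_def)
qed

text \<open>The left-hand side of \<open>lin_sol_energy_le\<close> for the difference
  \<open>w - u\<close>.\<close>

definition energy :: "(real \<Rightarrow> real) \<Rightarrow> (real \<Rightarrow> real) \<Rightarrow> (real \<Rightarrow> real) \<Rightarrow> (real \<Rightarrow> real) \<Rightarrow> real" where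
  "energy u u2 w w2 = M * (mass u2 - mass w2) + N * L * (mass w - mass u)"

text \<open>The difference of the images solves the linear problem whose right-hand side is the
  difference of the two \<open>F\<close>. The integral of that is at most \<open>q\<close> times the
  old energy, and it controls both the new energy and, pointwise, the new second derivative.\<close>

lemma step_contraction:
  assumes u: "sect u u2" and w: "sect w w2" and uw: "le2 u u2 w w2"
    and U: "T (F (mass u) u2) U U2" and W: "T (F (mass w) w2) W W2"
  shows "energy U U2 W W2 \<le> q * energy u u2 w w2"
    and "x \<in> {0..L} \<Longrightarrow> U2 x - W2 x \<le> L * (q * energy u u2 w w2)"
proof -
  let ?g = "\<lambda>x. F (mass w) w2 x - F (mass u) u2 x"
  have c: "continuous_on {0..L} u" "continuous_on {0..L} u2" "continuous_on {0..L} w" "continuous_on {0..L} w2"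
    using u w by (auto simp: sect_def)
  have g: "set_integrable lborel {0..L} ?g"
    using c by (intro set_integral_diff F_integrable)
  have UW: "le2 U U2 W W2" by (rule step_le2[OF u w uw U W])
  note D = lin_sol_diff[OF W U]
  have Jle: "mass u \<le> mass w" by (rule mass_mono[OF c(1,3) uw])
  have V0: "mass w2 \<le> mass u2"
    using uw by (intro integral_le integrable_continuous_real c) (auto simp: le2_def)
  have G: "(LINT x:{0..L}|lborel. ?g x) \<le> q * energy u u2 w w2"
  proof -
    have "(LINT x:{0..L}|lborel. ?g x) \<le> (LINT x:{0..L}|lborel. b * (B * (u2 x - w2 x) + K * (mass w - mass u)))"
    proof (rule set_integral_mono[OF g])
      show "set_integrable lborel {0..L} (\<lambda>x. b * (B * (u2 x - w2 x) + K * (mass w - mass u)))"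
        by (intro borel_integrable_atLeastAtMost' continuous_intros c)
      show "?g x \<le> b * (B * (u2 x - w2 x) + K * (mass w - mass u))" if "x \<in> {0..L}" for x
        using sect_mass[OF w] sect_deriv2[OF u that] uw that Jle
        by (intro F_diff_le) (auto simp: le2_def)
    qed
    also have "\<dots> = b * (B * (mass u2 - mass w2) + K * L * (mass w - mass u))"
    proof -
      have "(LINT x:{0..L}|lborel. b * (B * (u2 x - w2 x) + K * (mass w - mass u)))
        = integral {0..L} (\<lambda>x. b * (B * (u2 x - w2 x) + K * (mass w - mass u)))"
        by (intro LINT_Icc_eq_integral continuous_intros c)
      also have "\<dots> = b * (B * (mass u2 - mass w2) + K * L * (mass w - mass u))"
        using L c by (simp add: Henstock_Kurzweil_Integration.integral_add
            integrable_continuous_real continuous_intros integral_diff_continuous)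
      finally show ?thesis .
    qed
    also have "\<dots> = (b * B) * (mass u2 - mass w2) + (b * K) * (L * (mass w - mass u))"
      by (simp add: algebra_simps)
    also have "\<dots> \<le> (q * M) * (mass u2 - mass w2) + (q * N) * (L * (mass w - mass u))"
      using q_bounds V0 Jle L by (intro add_mono mult_right_mono) auto
    finally show ?thesis by (simp add: energy_def algebra_simps)
  qed
  have D2: "W2 x - U2 x \<le> 0" and D0: "0 \<le> W x - U x" if "x \<in> {0..L}" for x
    using UW that by (auto simp: le2_def)
  note cU = lin_sol_continuous[OF U] and cW = lin_sol_continuous[OF W]
  have "energy U U2 W W2 \<le> (LINT x:{0..L}|lborel. ?g x)"
    using lin_sol_energy_le[OF L D g D2] cU cW by (simp add: energy_def integral_diff_continuous)
  with G show "energy U U2 W W2 \<le> q * energy u u2 w w2" by simp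
  show "U2 x - W2 x \<le> L * (q * energy u u2 w w2)" if x: "x \<in> {0..L}"
  proof -
    have "- (W2 x - U2 x) \<le> L * (LINT x:{0..L}|lborel. ?g x)"
      by (rule lin_sol_deriv2_bound[OF L less_imp_le[OF M_pos] less_imp_le[OF N_pos] D g _ D2 D0 x])
        (use F_mono_sect[OF u w uw] in auto)
    also have "\<dots> \<le> L * (q * energy u u2 w w2)" using G L by (intro mult_left_mono) auto
    finally show ?thesis by simp
  qed
qed

section \<open>The lower and the upper chain\<close>

definition chain_from :: "(real \<Rightarrow> real) \<Rightarrow> (real \<Rightarrow> real) \<Rightarrow> (nat \<Rightarrow> real \<Rightarrow> real) \<Rightarrow> (nat \<Rightarrow> real \<Rightarrow> real) \<Rightarrow> bool" where
  "chain_from y0 y02 y y2 \<longleftrightarrow> (\<forall>x\<in>{0..L}. y 0 x = y0 x \<and> y2 0 x = y02 x) \<and>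
     (\<forall>k. T (F (mass (y k)) (y2 k)) (y (Suc k)) (y2 (Suc k)))"

text \<open>\<open>iter_seq\<close>, and hence \<open>chain_from\<close>, fixes the starting
  function on \<open>{0..L}\<close> only.\<close>

lemma sect_cong:
  assumes "sect u u2" "\<And>x. x \<in> {0..L} \<Longrightarrow> w x = u x \<and> w2 x = u2 x"
  shows "sect w w2"
proof -
  have "continuous_on {0..L} w" "continuous_on {0..L} w2"
    using assms continuous_on_cong[of "{0..L}" "{0..L}" w u] continuous_on_cong[of "{0..L}" "{0..L}" w2 u2]
    by (auto simp: sect_def)
  then show ?thesis using assms by (auto simp: sect_def le2_def)
qed

lemma chain_from_sect:
  assumes "chain_from y0 y02 y y2" "sect y0 y02"
  shows "sect (y k) (y2 k)"
proof (induction k)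
  case 0
  show ?case by (rule sect_cong[OF assms(2)]) (use assms(1) in \<open>auto simp: chain_from_def\<close>)
next
  case (Suc k)
  with assms(1) show ?case using step_sect unfolding chain_from_def by blast
qed

lemma chain_from_exists:
  assumes "sect y0 y02"
  shows "\<exists>y y2. chain_from y0 y02 y y2"
proof -
  \<comment> \<open>The sector is carried as an invariant because \<open>T_exists\<close> needs an
    integrable right-hand side, hence a continuous second component; the clause for
    \<open>k = 0\<close> pins the start.\<close>
  have "\<exists>f. \<forall>k. (sect (fst (f k)) (snd (f k)) \<and> (k = 0 \<longrightarrow> f k = (y0, y02))) \<and>
      T (F (mass (fst (f k))) (snd (f k))) (fst (f (Suc k))) (snd (f (Suc k)))"
  proof (rule dependent_nat_choice)
    show "\<exists>x. sect (fst x) (snd x) \<and> (0 = (0::nat) \<longrightarrow> x = (y0, y02))" using assms by auto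
  next
    fix x and k :: nat assume x: "sect (fst x) (snd x) \<and> (k = 0 \<longrightarrow> x = (y0, y02))"
    then obtain w w2 where "T (F (mass (fst x)) (snd x)) w w2"
      using T_exists[OF F_integrable] unfolding sect_def by blast
    moreover have "sect w w2" using step_sect calculation x by blast
    ultimately show "\<exists>y. (sect (fst y) (snd y) \<and> (Suc k = 0 \<longrightarrow> y = (y0, y02))) \<and>
        T (F (mass (fst x)) (snd x)) (fst y) (snd y)"
      by (intro exI[of _ "(w, w2)"]) simp
  qed
  then obtain f where f: "\<And>k. (k = 0 \<longrightarrow> f k = (y0, y02)) \<and>
      T (F (mass (fst (f k))) (snd (f k))) (fst (f (Suc k))) (snd (f (Suc k)))" by blast
  have "chain_from y0 y02 (\<lambda>k. fst (f k)) (\<lambda>k. snd (f k))"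
    using f[of 0] f by (auto simp: chain_from_def)
  then show ?thesis by blast
qed

lemma le2_trans: "le2 u u2 v v2 \<Longrightarrow> le2 v v2 w w2 \<Longrightarrow> le2 u u2 w w2"
  unfolding le2_def by (meson order_trans)

lemma chains_le2:
  assumes y: "chain_from y0 y02 y y2" "sect y0 y02" and z: "chain_from z0 z02 z z2" "sect z0 z02"
    and "le2 y0 y02 z0 z02"
  shows "le2 (y k) (y2 k) (z k) (z2 k)"
proof (induction k)
  case 0
  show ?case using assms by (auto simp: le2_def chain_from_def)
next
  case (Suc k)
  show ?case
    by (rule step_le2[OF chain_from_sect[OF y] chain_from_sect[OF z] Suc])
      (use y z in \<open>auto simp: chain_from_def\<close>)
qed

lemma chain_from_Suc:
  assumes "chain_from y0 y02 y y2"
  shows "chain_from (y 1) (y2 1) (\<lambda>k. y (Suc k)) (\<lambda>k. y2 (Suc k))"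
  using assms by (auto simp: chain_from_def)

text \<open>The chain is compared with its own shift, which starts at \<open>y 1\<close> and hence
  above 0.\<close>

lemma lower_chain_incseq:
  assumes y: "chain_from (\<lambda>_. 0) (\<lambda>_. 0) y y2" and "j \<le> k"
  shows "le2 (y j) (y2 j) (y k) (y2 k)"
  using \<open>j \<le> k\<close>
proof (induction k rule: dec_induct)
  case base
  show ?case by (simp add: le2_def)
next
  case (step k)
  have s: "sect (y 1) (y2 1)" by (rule chain_from_sect[OF y sect_zero])
  then have "le2 (\<lambda>_. 0) (\<lambda>_. 0) (y 1) (y2 1)" by (simp add: sect_def)
  from chains_le2[OF y sect_zero chain_from_Suc[OF y] s this] step show ?case
    using le2_trans by blast
qed

lemma upper_chain_decseq:
  assumes z: "chain_from \<beta> \<beta>2 z z2" and "j \<le> k"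
  shows "le2 (z k) (z2 k) (z j) (z2 j)"
  using \<open>j \<le> k\<close>
proof (induction k rule: dec_induct)
  case base
  show ?case by (simp add: le2_def)
next
  case (step k)
  have s: "sect (z 1) (z2 1)" by (rule chain_from_sect[OF z sect_beta])
  then have "le2 (z 1) (z2 1) \<beta> \<beta>2" by (simp add: sect_def)
  from chains_le2[OF chain_from_Suc[OF z] s z sect_beta this] step show ?case
    using le2_trans by blast
qed

lemma lower_le_upper_chain:
  assumes y: "chain_from (\<lambda>_. 0) (\<lambda>_. 0) y y2" and z: "chain_from \<beta> \<beta>2 z z2"
  shows "le2 (y j) (y2 j) (z k) (z2 k)"
proof -
  have "le2 (\<lambda>_. 0) (\<lambda>_. 0) \<beta> \<beta>2" using sect_beta by (simp add: sect_def)
  note diag = chains_le2[OF y sect_zero z sect_beta this]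
  have "le2 (y j) (y2 j) (y (max j k)) (y2 (max j k))" by (rule lower_chain_incseq[OF y]) simp
  from le2_trans[OF this diag] have "le2 (y j) (y2 j) (z (max j k)) (z2 (max j k))" .
  moreover have "le2 (z (max j k)) (z2 (max j k)) (z k) (z2 k)" by (rule upper_chain_decseq[OF z]) simp
  ultimately show ?thesis by (rule le2_trans)
qed

lemma chains_gap:
  assumes y: "chain_from (\<lambda>_. 0) (\<lambda>_. 0) y y2" and z: "chain_from \<beta> \<beta>2 z z2"
  shows "\<exists>\<epsilon>. \<epsilon> \<longlonglongrightarrow> 0 \<and> (\<forall>k. \<forall>x\<in>{0..L}. y2 (Suc k) x - z2 (Suc k) x \<le> \<epsilon> k \<and> z (Suc k) x - y (Suc k) x \<le> \<epsilon> k)"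
proof -
  define e where "e k = energy (y k) (y2 k) (z k) (z2 k)" for k
  note sy = chain_from_sect[OF y sect_zero] and sz = chain_from_sect[OF z sect_beta]
  note yz = lower_le_upper_chain[OF y z]
  have Ty: "T (F (mass (y k)) (y2 k)) (y (Suc k)) (y2 (Suc k))"
    and Tz: "T (F (mass (z k)) (z2 k)) (z (Suc k)) (z2 (Suc k))" for k
    using y z by (auto simp: chain_from_def)
  note step = step_contraction[OF sy sz yz Ty Tz]
  have e_le: "e k \<le> q^k * e 0" for k
  proof (induction k)
    case (Suc k)
    have "e (Suc k) \<le> q * e k" unfolding e_def by (rule step(1))
    also have "\<dots> \<le> q * (q^k * e 0)" using q_bounds Suc by (intro mult_left_mono)
    finally show ?case by simp
  qed simp
  define \<delta> where "\<delta> k = L * (q * (q^k * e 0))" for k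
  have gap2: "y2 (Suc k) x - z2 (Suc k) x \<le> \<delta> k" if "x \<in> {0..L}" for k x
  proof -
    have "y2 (Suc k) x - z2 (Suc k) x \<le> L * (q * e k)" unfolding e_def by (rule step(2)[OF that])
    also have "\<dots> \<le> \<delta> k" unfolding \<delta>_def using L q_bounds e_le by (intro mult_left_mono) auto
    finally show ?thesis .
  qed
  \<comment> \<open>The sign is read off from the ordering of the chains at the point 0.\<close>
  have \<delta>0: "0 \<le> \<delta> k" for k
  proof -
    have "z2 (Suc k) 0 \<le> y2 (Suc k) 0" using yz[of "Suc k" "Suc k"] L by (simp add: le2_def)
    with gap2[of 0 k] L show ?thesis by simp
  qed
  have gap: "z (Suc k) x - y (Suc k) x \<le> \<delta> k * L^2" if "x \<in> {0..L}" for k x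
  proof -
    obtain d1 where d1: "deriv2_on L (\<lambda>x. z (Suc k) x - y (Suc k) x) d1 (\<lambda>x. z2 (Suc k) x - y2 (Suc k) x)"
      and bc: "hinged_bc L (\<lambda>x. z (Suc k) x - y (Suc k) x) (\<lambda>x. z2 (Suc k) x - y2 (Suc k) x)"
      using lin_sol_diff[OF Tz[of k] Ty[of k]] W41_derivs(1) unfolding lin_sol_def by blast
    show ?thesis
    proof (rule le_of_deriv2_ge[OF d1 _ _ _ that \<delta>0])
      show "- \<delta> k \<le> z2 (Suc k) x - y2 (Suc k) x" if "x \<in> {0..L}" for x
        using gap2[OF that, of k] by simp
    qed (use bc in \<open>auto simp: hinged_bc_def\<close>)
  qed
  \<comment> \<open>The factor \<open>1 + L^2\<close> dominates both 1 and \<open>L^2\<close>, so a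
    single null sequence serves the functions and their second derivatives.\<close>
  have "(\<lambda>k. L * (q * (q^k * e 0)) * (1 + L^2)) \<longlonglongrightarrow> L * (q * (0 * e 0)) * (1 + L^2)"
    using q_bounds by (intro tendsto_intros) auto
  then have lim: "(\<lambda>k. \<delta> k * (1 + L^2)) \<longlonglongrightarrow> 0" by (simp add: \<delta>_def)
  have le: "\<delta> k \<le> \<delta> k * (1 + L^2)" "\<delta> k * L^2 \<le> \<delta> k * (1 + L^2)" for k
    using \<delta>0[of k] by (simp_all add: algebra_simps)
  show ?thesis
    using order_trans[OF gap2 le(1)] order_trans[OF gap le(2)] lim
    by (intro exI[of _ "\<lambda>k. \<delta> k * (1 + L^2)"]) blast
qed

section \<open>Solutions in the sector as fixed points\<close>

definition fixed :: "(real \<Rightarrow> real) \<Rightarrow> (real \<Rightarrow> real) \<Rightarrow> bool" where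
  "fixed u u2 \<longleftrightarrow> sect u u2 \<and> T (F (mass u) u2) u u2"

text \<open>A fixed point generates a constant chain, to which the comparison of chains
  applies.\<close>

lemma fixed_between:
  assumes u: "fixed u u2"
    and y: "chain_from (\<lambda>_. 0) (\<lambda>_. 0) y y2" and z: "chain_from \<beta> \<beta>2 z z2"
  shows "le2 (y k) (y2 k) u u2" "le2 u u2 (z k) (z2 k)"
proof -
  have s: "sect u u2" and c: "chain_from u u2 (\<lambda>_. u) (\<lambda>_. u2)"
    using u by (auto simp: fixed_def chain_from_def)
  have "le2 (\<lambda>_. 0) (\<lambda>_. 0) u u2" "le2 u u2 \<beta> \<beta>2" using s by (auto simp: sect_def)
  with chains_le2[OF y sect_zero c s] chains_le2[OF c s z sect_beta]
  show "le2 (y k) (y2 k) u u2" "le2 u u2 (z k) (z2 k)" by auto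
qed

lemma fixed_uniform_limit:
  assumes u: "fixed u u2"
    and y: "chain_from (\<lambda>_. 0) (\<lambda>_. 0) y y2" and z: "chain_from \<beta> \<beta>2 z z2"
  shows "uniform_limit {0..L} y u sequentially" "uniform_limit {0..L} z u sequentially"
proof -
  obtain \<epsilon> where \<epsilon>: "\<epsilon> \<longlonglongrightarrow> 0" "\<And>k x. x \<in> {0..L} \<Longrightarrow> z (Suc k) x - y (Suc k) x \<le> \<epsilon> k"
    using chains_gap[OF y z] by blast
  have "y (Suc k) x \<le> u x" "u x \<le> z (Suc k) x" if "x \<in> {0..L}" for k x
    using fixed_between[OF u y z, of "Suc k"] that by (auto simp: le2_def)
  then have "\<bar>y (Suc k) x - u x\<bar> \<le> \<epsilon> k" "\<bar>z (Suc k) x - u x\<bar> \<le> \<epsilon> k" if "x \<in> {0..L}" for k x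
    using \<epsilon>(2)[OF that, of k] that by (smt (verit))+
  with \<epsilon>(1) show "uniform_limit {0..L} y u sequentially" "uniform_limit {0..L} z u sequentially"
    by (auto intro: uniform_limit_of_gap)
qed

text \<open>The limits of the second derivatives and of the integrals along the lower chain determine
  a right-hand side, whose solution is squeezed between the two chains and hence is a fixed point.\<close>

lemma fixed_exists: "\<exists>u u2. fixed u u2"
proof -
  obtain y y2 where y: "chain_from (\<lambda>_. 0) (\<lambda>_. 0) y y2" using chain_from_exists[OF sect_zero] by blast
  obtain z z2 where z: "chain_from \<beta> \<beta>2 z z2" using chain_from_exists[OF sect_beta] by blast
  note sy = chain_from_sect[OF y sect_zero] and sz = chain_from_sect[OF z sect_beta]
  note yz = lower_le_upper_chain[OF y z]
  have c: "continuous_on {0..L} (y k)" "continuous_on {0..L} (z k)" "continuous_on {0..L} (y2 k)" for k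
    using sy sz by (auto simp: sect_def)
  obtain \<epsilon> where \<epsilon>: "\<epsilon> \<longlonglongrightarrow> 0" and gap2: "\<And>k x. x \<in> {0..L} \<Longrightarrow> y2 (Suc k) x - z2 (Suc k) x \<le> \<epsilon> k"
    and gap: "\<And>k x. x \<in> {0..L} \<Longrightarrow> z (Suc k) x - y (Suc k) x \<le> \<epsilon> k"
    using chains_gap[OF y z] by blast
  \<comment> \<open>The second derivatives of the lower chain decrease, and on \<open>{0..L}\<close>
    each \<open>z2 k\<close> bounds them from below, so there the infimum is their limit.\<close>
  define v where "v x = (INF k. y2 k x)" for x
  have v: "v x \<le> y2 k x" "z2 k x \<le> v x" if "x \<in> {0..L}" for x k
  proof -
    have le: "z2 i x \<le> y2 j x" for i j using yz[of j i] that by (simp add: le2_def)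
    show "v x \<le> y2 k x" unfolding v_def
      by (intro cINF_lower bdd_belowI2[where m = "z2 0 x"]) (auto intro: le)
    show "z2 k x \<le> v x" unfolding v_def by (intro cINF_greatest) (auto intro: le)
  qed
  define J where "J = (SUP k. mass (y k))"
  have J: "mass (y k) \<le> J" "J \<le> mass (z k)" for k
  proof -
    have le: "mass (y i) \<le> mass (z j)" for i j by (rule mass_mono[OF c(1,2) yz])
    show "mass (y k) \<le> J" unfolding J_def
      by (intro cSUP_upper bdd_aboveI2[where M = "mass (z 0)"]) (auto intro: le)
    show "J \<le> mass (z k)" unfolding J_def by (intro cSUP_least) (auto intro: le)
  qed
  have near: "\<bar>y2 (Suc k) x - v x\<bar> \<le> \<epsilon> k" if "x \<in> {0..L}" for k x
    using v[OF that, of "Suc k"] gap2[OF that, of k] by linarith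
  \<comment> \<open>Uniformity makes \<open>v\<close> continuous, so that \<open>F J v\<close> is an
    admissible right-hand side.\<close>
  have "uniform_limit {0..L} y2 v sequentially" by (rule uniform_limit_of_gap[OF \<epsilon> near])
  then have vc: "continuous_on {0..L} v"
    by (rule uniform_limit_theorem[rotated]) (use c(3) in auto)
  obtain u u2 where u: "T (F J v) u u2" using T_exists[OF F_integrable[OF vc]] by blast
  have JB: "J \<le> B" "mass (z k) \<le> B" for k
    using sect_mass(2)[OF sz] J(2)[of 0] by (auto intro: order_trans)
  have K: "- K \<le> y2 k x" "- K \<le> v x" if "x \<in> {0..L}" for k x
    using sect_deriv2(1)[OF sy that] sect_deriv2(1)[OF sz that, of 0] v(2)[OF that, of 0] by auto
  have yu: "le2 (y (Suc k)) (y2 (Suc k)) u u2" for k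
  proof (rule T_mono[OF _ u])
    show "T (F (mass (y k)) (y2 k)) (y (Suc k)) (y2 (Suc k))" using y by (simp add: chain_from_def)
    show "AE x in lborel. x \<in> {0<..<L} \<longrightarrow> F (mass (y k)) (y2 k) x \<le> F J v x"
      using v J JB K by (intro AE_I2 impI F_mono) auto
  qed
  have uz: "le2 u u2 (z (Suc k)) (z2 (Suc k))" for k
  proof (rule T_mono[OF u])
    show "T (F (mass (z k)) (z2 k)) (z (Suc k)) (z2 (Suc k))" using z by (simp add: chain_from_def)
    show "AE x in lborel. x \<in> {0<..<L} \<longrightarrow> F J v x \<le> F (mass (z k)) (z2 k) x"
      using v J JB K by (intro AE_I2 impI F_mono) auto
  qed
  note uc = lin_sol_continuous[OF u]
  have "u2 x = v x" if "x \<in> {0..L}" for x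
  proof -
    have "\<bar>u2 x - v x\<bar> \<le> \<epsilon> k" for k
    proof -
      have "u2 x \<le> y2 (Suc k) x" "z2 (Suc k) x \<le> u2 x" using yu[of k] uz[of k] that by (auto simp: le2_def)
      with v[OF that, of "Suc k"] gap2[OF that, of k] show ?thesis by linarith
    qed
    with \<epsilon> have "\<bar>u2 x - v x\<bar> \<le> 0" by (intro LIMSEQ_le_const) auto
    then show ?thesis by simp
  qed
  moreover have "mass u = J"
  proof -
    have "\<bar>mass u - J\<bar> \<le> L * \<epsilon> k" for k
    proof -
      have "mass (y (Suc k)) \<le> mass u" "mass u \<le> mass (z (Suc k))"
        by (rule mass_mono[OF c(1) uc(1) yu] mass_mono[OF uc(1) c(2) uz])+
      moreover have "mass (z (Suc k)) - mass (y (Suc k)) \<le> L * \<epsilon> k"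
      proof -
        have "integral {0..L} (\<lambda>x. z (Suc k) x - y (Suc k) x) \<le> integral {0..L} (\<lambda>x. \<epsilon> k)"
          using gap c by (intro integral_le integrable_continuous_real continuous_intros) auto
        then show ?thesis using L c by (simp add: integral_diff_continuous)
      qed
      ultimately show ?thesis using J[of "Suc k"] by linarith
    qed
    moreover have "(\<lambda>k. L * \<epsilon> k) \<longlonglongrightarrow> L * 0" using \<epsilon> by (intro tendsto_intros)
    ultimately have "\<bar>mass u - J\<bar> \<le> 0" by (intro LIMSEQ_le_const) auto
    then show ?thesis by simp
  qed
  ultimately have "T (F (mass u) u2) u u2"
    by (intro lin_sol_cong_AE[OF u]) (auto simp: F_def)
  moreover have "sect u u2"
    using uc le2_trans[OF _ yu[of 0]] le2_trans[OF uz[of 0]] sy[of 1] sz[of 1] by (simp add: sect_def)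
  ultimately show ?thesis unfolding fixed_def by blast
qed

lemma fixed_unique:
  assumes u: "fixed u u2" and w: "fixed w w2" and x: "x \<in> {0..L}"
  shows "u x = w x"
proof -
  obtain y y2 where y: "chain_from (\<lambda>_. 0) (\<lambda>_. 0) y y2" using chain_from_exists[OF sect_zero] by blast
  obtain z z2 where z: "chain_from \<beta> \<beta>2 z z2" using chain_from_exists[OF sect_beta] by blast
  show ?thesis
    using tendsto_uniform_limitI[OF fixed_uniform_limit(1)[OF u y z] x]
      tendsto_uniform_limitI[OF fixed_uniform_limit(1)[OF w y z] x] by (rule LIMSEQ_unique)
qed

text \<open>At a fixed point the shifts \<open>b * B * u2\<close> and \<open>b * K * mass u\<close>
  occur on both sides and cancel.\<close>

lemma fixed_iff_is_sol:
  "(\<exists>u2. fixed u u2) \<longleftrightarrow> u \<in> sector L lam \<and> is_sol L EI a b c p u"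
proof
  assume "\<exists>u2. fixed u u2"
  then obtain u2 d1 d3 d4 where s: "sect u u2" and d: "W41 L u d1 u2 d3 d4" "hinged_bc L u u2"
    and eq: "AE x in lborel. x \<in> {0<..<L} \<longrightarrow> d4 x - M * u2 x + N * mass u = F (mass u) u2 x"
    unfolding fixed_def lin_sol_def by blast
  have "u \<in> sector L lam"
    using s W41_derivs(1)[OF d(1)] unfolding sector_def sect_def le2_def \<beta>_def \<beta>2_def by blast
  moreover from eq have "AE x in lborel. x \<in> {0<..<L} \<longrightarrow>
      d4 x - (a + b * mass u) * u2 x + c * mass u = p x / EI"
    by eventually_elim (auto simp: F_def M_eq N_eq algebra_simps)
  ultimately show "u \<in> sector L lam \<and> is_sol L EI a b c p u"
    using d unfolding is_sol_def by blast
next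
  assume *: "u \<in> sector L lam \<and> is_sol L EI a b c p u"
  then obtain d1 u2 d3 d4 where d: "W41 L u d1 u2 d3 d4" "hinged_bc L u u2"
    and eq: "AE x in lborel. x \<in> {0<..<L} \<longrightarrow> d4 x - (a + b * mass u) * u2 x + c * mass u = p x / EI"
    unfolding is_sol_def by blast
  obtain e1 e2 where e: "deriv2_on L u e1 e2" and bounds: "\<forall>x\<in>{0..L}. 0 \<le> u x \<and> u x \<le> lam * sin (pi / L * x) \<and>
      e2 x \<le> 0 \<and> - lam * (pi / L)^2 * sin (pi / L * x) \<le> e2 x"
    using * unfolding sector_def by blast
  have "e2 x = u2 x" if "x \<in> {0..L}" for x
    using deriv2_on_unique[OF L e W41_derivs(1)[OF d(1)] refl that] .
  with bounds have "sect u u2"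
    using W41_continuous[OF d(1)] by (auto simp: sect_def le2_def \<beta>_def \<beta>2_def)
  moreover from eq have "AE x in lborel. x \<in> {0<..<L} \<longrightarrow> d4 x - M * u2 x + N * mass u = F (mass u) u2 x"
    by eventually_elim (auto simp: F_def M_eq N_eq algebra_simps)
  ultimately show "\<exists>u2. fixed u u2" using d unfolding fixed_def lin_sol_def by blast
qed

text \<open>By concavity an interior zero forces \<open>u\<close> to vanish identically. Then
  \<open>p / EI \<le> d4\<close> almost everywhere while \<open>d4\<close> has integral 0, so the
  nonnegative \<open>p\<close> would vanish almost everywhere.\<close>

lemma fixed_positive:
  assumes u: "fixed u u2" and nz: "\<not> (AE x in lborel. x \<in> {0<..<L} \<longrightarrow> p x = 0)" and r: "r \<in> {0<..<L}"
  shows "0 < u r"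
proof (rule ccontr)
  obtain d1 d3 d4 where s: "sect u u2" and d: "W41 L u d1 u2 d3 d4" "hinged_bc L u u2"
    and eq: "AE x in lborel. x \<in> {0<..<L} \<longrightarrow> d4 x - M * u2 x + N * mass u = F (mass u) u2 x"
    using u unfolding fixed_def lin_sol_def by blast
  note W = W41_derivs[OF d(1)]
  have u0: "0 \<le> u x" "u2 x \<le> 0" if "x \<in> {0..L}" for x using s that by (auto simp: sect_def le2_def)
  assume "\<not> 0 < u r"
  with u0[of r] r have "u r = 0" by auto
  then have uz: "u x = 0" if "x \<in> {0..L}" for x
    using concave_interior_zero[OF W(1) u0(2,1) r _ that] by blast
  have "deriv2_on L (\<lambda>_. 0) (\<lambda>_. 0) (\<lambda>_. 0)" by (simp add: deriv2_on_def)
  from deriv2_on_unique[OF L W(1) this uz] have u2z: "u2 x = 0" if "x \<in> {0..L}" for x using that by blast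
  have d3z: "d3 x = 0" if "x \<in> {0..L}" for x
    by (rule has_real_derivative_within_unique[OF L that W(4)[OF that], of "\<lambda>_. 0"]) (use u2z in auto)
  have mz: "mass u = 0" using integral_cong[of "{0..L}" u "\<lambda>_. 0"] uz by simp
  have "AE x in lborel. x \<in> {0<..<L} \<longrightarrow> p x / EI \<le> d4 x"
    using eq by eventually_elim (auto simp: mz u2z F_def)
  then have "(LINT x:{0..L}|lborel. p x / EI) \<le> (LINT x:{0..L}|lborel. d4 x)"
    by (intro set_integral_mono_AE set_integrable_divide p_int W(5) AE_Ioo_imp_AE_Icc)
  also have "\<dots> = 0" using W(6)[of L] d3z L by simp
  finally have "(LINT x:{0..L}|lborel. p x) \<le> 0" using EI by (simp add: divide_le_0_iff)
  moreover have p0: "AE x in lborel. 0 \<le> indicator {0..L} x *\<^sub>R p x"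
    using AE_Ioo_imp_AE_Icc[OF p_nonneg] by eventually_elim (auto simp: indicator_def)
  ultimately have "(LINT x|lborel. indicator {0..L} x *\<^sub>R p x) = 0"
    unfolding set_lebesgue_integral_def using integral_nonneg_AE[OF p0] by simp
  then have "AE x in lborel. indicator {0..L} x *\<^sub>R p x = 0"
    using integral_nonneg_eq_0_iff_AE[OF p_int[unfolded set_integrable_def] p0] by blast
  then have "AE x in lborel. x \<in> {0<..<L} \<longrightarrow> p x = 0" by eventually_elim (auto simp: indicator_def)
  with nz show False by blast
qed

section \<open>Translation between \<open>iter_seq\<close> and \<open>chain_from\<close>\<close>

lemma F_iter: "F J e x = p x / EI + b * e x * J - 2 * b * lam * (L / pi) * e x + b * lam * (pi^2 / L^2) * J"
  by (simp add: F_def B_def K_def power_divide algebra_simps)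

text \<open>\<open>iter_seq\<close> quantifies the second derivatives afresh at each index. One is
  chosen per index, and uniqueness substitutes it for the one delivered by the preceding linear
  problem.\<close>

lemma iter_seq_imp_chain_from:
  assumes y: "iter_seq L EI a b c lam p y0 y" and y0: "deriv2_on L y0 y01 y02"
  shows "\<exists>y2. chain_from y0 y02 y y2"
proof -
  have "\<forall>k. \<exists>e2. (\<exists>e1. deriv2_on L (y k) e1 e2) \<and> (\<exists>d2. T (F (mass (y k)) e2) (y (Suc k)) d2)"
    using y unfolding iter_seq_def lin_sol_def F_iter M_def N_def by blast
  then obtain y2 where y2: "\<And>k. (\<exists>e1. deriv2_on L (y k) e1 (y2 k)) \<and> (\<exists>d2. T (F (mass (y k)) (y2 k)) (y (Suc k)) d2)"
    by metis
  have "T (F (mass (y k)) (y2 k)) (y (Suc k)) (y2 (Suc k))" for k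
  proof -
    obtain d2 where d2: "T (F (mass (y k)) (y2 k)) (y (Suc k)) d2" using y2 by blast
    obtain d1 e1 where "deriv2_on L (y (Suc k)) d1 d2" "deriv2_on L (y (Suc k)) e1 (y2 (Suc k))"
      using lin_sol_deriv2_on[OF d2] y2[of "Suc k"] by blast
    from deriv2_on_unique[OF L this refl] show ?thesis
      by (rule lin_sol_cong_deriv2[OF d2]) (use L in auto)
  qed
  moreover have "y 0 x = y0 x \<and> y2 0 x = y02 x" if "x \<in> {0..L}" for x
  proof -
    have eq: "\<And>x. x \<in> {0..L} \<Longrightarrow> y 0 x = y0 x" using y by (auto simp: iter_seq_def)
    obtain e1 where "deriv2_on L (y 0) e1 (y2 0)" using y2 by blast
    from deriv2_on_unique[OF L this y0 eq that] eq[OF that] show ?thesis by simp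
  qed
  ultimately show ?thesis unfolding chain_from_def by blast
qed

lemma chain_from_imp_iter_seq:
  assumes y: "chain_from y0 y02 y y2" and y0: "deriv2_on L y0 y01 y02"
  shows "\<exists>y. iter_seq L EI a b c lam p y0 y"
proof -
  \<comment> \<open>The start is replaced by \<open>y0\<close> itself, whose derivatives are given;
    later members have theirs from the linear problem.\<close>
  define w where "w k = (if k = 0 then y0 else y k)" for k
  define w2 where "w2 k = (if k = 0 then y02 else y2 k)" for k
  have eq: "w k x = y k x" "w2 k x = y2 k x" if "x \<in> {0..L}" for k x
    using y that by (auto simp: w_def w2_def chain_from_def)
  have T: "T (F (mass (w k)) (w2 k)) (w (Suc k)) (w2 (Suc k))" for k
  proof -
    have "T (F (mass (y k)) (y2 k)) (w (Suc k)) (w2 (Suc k))"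
      using y by (simp add: chain_from_def w_def w2_def)
    moreover have "mass (w k) = mass (y k)" by (rule integral_cong) (rule eq)
    ultimately show ?thesis
      by (elim lin_sol_cong_AE) (use eq in \<open>auto simp: F_def\<close>)
  qed
  have "\<exists>e1. deriv2_on L (w k) e1 (w2 k)" for k
    using y0 lin_sol_deriv2_on[OF T] by (cases k) (auto simp: w_def w2_def)
  moreover have "\<forall>x\<in>{0..L}. w 0 x = y0 x" by (simp add: w_def)
  ultimately have "iter_seq L EI a b c lam p y0 w"
    using T unfolding iter_seq_def lin_sol_def F_iter M_def N_def by blast
  then show ?thesis by blast
qed

end

section \<open>Lower and upper solutions, and the theorem\<close>

text \<open>Because \<open>N\<close> is positive, the bound forces \<open>sigma\<close> to be
  positive, hence also its denominator, which may then be multiplied out.\<close>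

lemma linear_beam_of_sigma:
  assumes L: "0 < L" and M: "0 < M" and N: "0 < N"
    and le: "N \<le> 4 * M / L^3 * sigma (sqrt M * L)"
  shows "linear_beam L (sqrt M) N"
proof
  let ?m = "sqrt M"
  let ?D = "6 * (?m * L) * cosh (?m * L) + 6 * (?m * L) - 12 * sinh (?m * L) - (?m * L)^3"
  have m: "0 < ?m" using M by simp
  have "0 < 4 * M / L^3 * sigma (?m * L)" using N le by linarith
  moreover have "0 < 4 * M / L^3" using M L by simp
  ultimately have "0 < sigma (?m * L)" by (rule zero_less_mult_pos)
  then have "0 < 3 * (?m * L)^3 / ?D" by (simp add: sigma_def)
  moreover have "0 < 3 * (?m * L)^3" using m L by simp
  ultimately have D: "0 < ?D" using zero_less_divide_iff[of "3 * (?m * L)^3" ?D] by linarith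
  have "N \<le> 4 * M / L^3 * (3 * (?m * L)^3 / ?D)" using le by (simp only: sigma_def)
  then have "N * ?D \<le> 4 * M / L^3 * (3 * (?m * L)^3 / ?D) * ?D" using D by (intro mult_right_mono) auto
  also have "\<dots> = 4 * M / L^3 * (3 * (?m * L)^3)" using D by simp
  also have "\<dots> = 12 * M * ?m^3" using L by (simp add: power_mult_distrib)
  also have "\<dots> = 12 * (?m^2) * ?m^3" using M by simp
  also have "\<dots> = 12 * ?m^5" by (simp add: eval_nat_numeral)
  finally show "N * ?D \<le> 12 * ?m^5" .
qed (use L M N in auto)

lemma lower_sol_zero:
  assumes "0 < EI" "AE x in lborel. x \<in> {0<..<L} \<longrightarrow> p x \<ge> 0"
  shows "lower_sol L EI a b c p (\<lambda>_. 0)"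
proof -
  have "W41 L (\<lambda>_. 0) (\<lambda>_. 0) (\<lambda>_. 0) (\<lambda>_. 0) (\<lambda>_. 0)" "hinged_bc L (\<lambda>_. 0) (\<lambda>_. 0)"
    by (simp_all add: W41_def deriv2_on_def set_integrable_def hinged_bc_def)
  moreover have "AE x in lborel. x \<in> {0<..<L} \<longrightarrow>
      0 - (a + b * integral {0..L} (\<lambda>_. 0)) * 0 + c * integral {0..L} (\<lambda>_. 0) \<le> p x / EI"
    using assms(2) by eventually_elim (use assms(1) in auto)
  ultimately show ?thesis unfolding lower_sol_def by blast
qed

text \<open>The bound on \<open>p / EI\<close> is the operator evaluated at the sine, whose integral
  is \<open>2 * lam * L / pi\<close>.\<close>

lemma upper_sol_sine:
  assumes L: "0 < L" and p_bound: "AE x in lborel. x \<in> {0<..<L} \<longrightarrow>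
      p x / EI \<le> (lam * pi^4 / L^4 + a * lam * pi^2 / L^2 + 2 * b * lam^2 * pi / L)
                     * sin (pi / L * x) + 2 * lam * c * L / pi"
  shows "upper_sol L EI a b c p (\<lambda>x. lam * sin (pi / L * x))"
proof -
  have eq: "(lam * pi^4 / L^4 + a * lam * pi^2 / L^2 + 2 * b * lam^2 * pi / L) * sin (pi / L * x) + 2 * lam * c * L / pi
      = lam * (pi / L)^4 * sin (pi / L * x)
        - (a + b * integral {0..L} (\<lambda>x. lam * sin (pi / L * x))) * (- lam * (pi / L)^2 * sin (pi / L * x))
        + c * integral {0..L} (\<lambda>x. lam * sin (pi / L * x))" for x
    unfolding integral_sine[OF L] using L by (simp add: field_simps power2_eq_square eval_nat_numeral)
  have "AE x in lborel. x \<in> {0<..<L} \<longrightarrow> p x / EI \<le> lam * (pi / L)^4 * sin (pi / L * x)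
        - (a + b * integral {0..L} (\<lambda>x. lam * sin (pi / L * x))) * (- lam * (pi / L)^2 * sin (pi / L * x))
        + c * integral {0..L} (\<lambda>x. lam * sin (pi / L * x))"
    using p_bound unfolding eq .
  then show ?thesis
    unfolding upper_sol_def using W41_sine[of L lam "pi / L"] hinged_sine[OF L] by blast
qed

theorem theorem6p1:
  fixes L EI H EcAc Lc n :: real and p :: "real \<Rightarrow> real"
  assumes pos: "L > 0" "EI > 0" "H > 0" "EcAc > 0" "Lc > 0" "n > 0"
    and p_int: "set_integrable lborel {0..L} p"
    and p_nonneg: "AE x in lborel. x \<in> {0<..<L} \<longrightarrow> p x \<ge> 0"
    and p_nonzero: "\<not> (AE x in lborel. x \<in> {0<..<L} \<longrightarrow> p x = 0)"
  defines "a \<equiv> H / EI"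
    and "b \<equiv> (8 * n / L) * (EcAc / (EI * Lc))"
    and "c \<equiv> (8 * n / L) * ((8 * n / L) * (EcAc / (EI * Lc)))"
    and "lam \<equiv> L / 100"
  assumes p_bound: "AE x in lborel. x \<in> {0<..<L} \<longrightarrow>
      p x / EI \<le> (lam * pi^4 / L^4 + a * lam * pi^2 / L^2 + 2 * b * lam^2 * pi / L)
                     * sin (pi / L * x) + 2 * lam * c * L / pi"
  shows "lower_sol L EI a b c p (\<lambda>_. 0) \<and>
         upper_sol L EI a b c p (\<lambda>x. L / 100 * sin (pi / L * x)) \<and>
         ((n \<ge> 1 / 15.32 \<and>
           c * (1 + pi^2 / (800 * n))
             \<le> 4 * (a + c * L^3 / (400 * n * pi)) / L^3
                 * sigma (sqrt (a + c * L^3 / (400 * n * pi)) * L))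
          \<longrightarrow> (\<exists>u. u \<in> sector L lam \<and> is_sol L EI a b c p u \<and> (\<forall>x\<in>{0<..<L}. u x > 0) \<and>
                 (\<forall>v\<in>sector L lam. is_sol L EI a b c p v \<and> (\<forall>x\<in>{0<..<L}. v x > 0)
                       \<longrightarrow> (\<forall>x\<in>{0..L}. v x = u x)) \<and>
                 (\<forall>y0\<in>{(\<lambda>_. 0), (\<lambda>x. L / 100 * sin (pi / L * x))}.
                    (\<exists>y. iter_seq L EI a b c lam p y0 y) \<and>
                    (\<forall>y. iter_seq L EI a b c lam p y0 y \<longrightarrow> uniform_limit {0..L} y u sequentially))))"
proof (intro conjI impI)
  show "lower_sol L EI a b c p (\<lambda>_. 0)"
    using pos(2) p_nonneg by (rule lower_sol_zero)
  show "upper_sol L EI a b c p (\<lambda>x. L / 100 * sin (pi / L * x))"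
    using upper_sol_sine[OF pos(1) p_bound] by (simp only: lam_def)
next
  assume cond: "n \<ge> 1 / 15.32 \<and>
           c * (1 + pi^2 / (800 * n))
             \<le> 4 * (a + c * L^3 / (400 * n * pi)) / L^3
                 * sigma (sqrt (a + c * L^3 / (400 * n * pi)) * L)"
  have abc: "0 < a" "0 < b" "0 < c" "0 < lam"
    using pos by (simp_all add: a_def b_def c_def lam_def)
  have cb: "c = 8 * n / L * b" by (simp add: c_def b_def)
  \<comment> \<open>With \<open>b = c * L / (8 * n)\<close> and \<open>lam = L / 100\<close> the
    shifted coefficients become the expressions of the hypothesis.\<close>
  have M: "a + 2 * b * lam * L / pi = a + c * L^3 / (400 * n * pi)"
    unfolding cb lam_def using pos by (simp add: field_simps power3_eq_cube)
  have N: "c + b * lam * pi^2 / L^2 = c * (1 + pi^2 / (800 * n))"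
    unfolding cb lam_def using pos by (simp add: field_simps power2_eq_square)
  have "linear_beam L (sqrt (a + 2 * b * lam * L / pi)) (c + b * lam * pi^2 / L^2)"
    unfolding M N using cond abc pos by (intro linear_beam_of_sigma) (auto intro!: add_pos_pos mult_pos_pos)
  then interpret beam L EI a b c lam p
    using pos abc p_int p_nonneg p_bound by (intro beam.intro)
  have \<beta>: "(\<lambda>x. L / 100 * sin (pi / L * x)) = \<beta>"
    unfolding fun_eq_iff \<beta>_def by (simp add: lam_def)
  obtain u u2 where u: "fixed u u2" using fixed_exists by blast
  obtain y y2 where y: "chain_from (\<lambda>_. 0) (\<lambda>_. 0) y y2" using chain_from_exists[OF sect_zero] by blast
  obtain z z2 where z: "chain_from \<beta> \<beta>2 z z2" using chain_from_exists[OF sect_beta] by blast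
  have d0: "deriv2_on L (\<lambda>_. 0) (\<lambda>_. 0) (\<lambda>_. 0)" by (simp add: deriv2_on_def)
  note d\<beta> = W41_derivs(1)[OF W41_beta]
  have zero: "(\<exists>y. iter_seq L EI a b c lam p (\<lambda>_. 0) y) \<and>
      (\<forall>y. iter_seq L EI a b c lam p (\<lambda>_. 0) y \<longrightarrow> uniform_limit {0..L} y u sequentially)"
    using chain_from_imp_iter_seq[OF y d0] iter_seq_imp_chain_from[OF _ d0] fixed_uniform_limit(1)[OF u _ z]
    by blast
  have beta: "(\<exists>y. iter_seq L EI a b c lam p \<beta> y) \<and>
      (\<forall>y. iter_seq L EI a b c lam p \<beta> y \<longrightarrow> uniform_limit {0..L} y u sequentially)"
    using chain_from_imp_iter_seq[OF z d\<beta>] iter_seq_imp_chain_from[OF _ d\<beta>] fixed_uniform_limit(2)[OF u y]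
    by blast
  have "\<forall>v\<in>sector L lam. is_sol L EI a b c p v \<longrightarrow> (\<forall>x\<in>{0..L}. v x = u x)"
    using fixed_iff_is_sol fixed_unique[OF _ u] by blast
  moreover have "u \<in> sector L lam" "is_sol L EI a b c p u" using u fixed_iff_is_sol by blast+
  moreover have "\<forall>x\<in>{0<..<L}. 0 < u x" using fixed_positive[OF u p_nonzero] by blast
  moreover have "\<forall>y0\<in>{(\<lambda>_. 0), \<beta>}. (\<exists>y. iter_seq L EI a b c lam p y0 y) \<and>
      (\<forall>y. iter_seq L EI a b c lam p y0 y \<longrightarrow> uniform_limit {0..L} y u sequentially)"
    using zero beta by blast
  ultimately show "\<exists>u. u \<in> sector L lam \<and> is_sol L EI a b c p u \<and> (\<forall>x\<in>{0<..<L}. u x > 0) \<and>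
                 (\<forall>v\<in>sector L lam. is_sol L EI a b c p v \<and> (\<forall>x\<in>{0<..<L}. v x > 0)
                       \<longrightarrow> (\<forall>x\<in>{0..L}. v x = u x)) \<and>
                 (\<forall>y0\<in>{(\<lambda>_. 0), (\<lambda>x. L / 100 * sin (pi / L * x))}.
                    (\<exists>y. iter_seq L EI a b c lam p y0 y) \<and>
                    (\<forall>y. iter_seq L EI a b c lam p y0 y \<longrightarrow> uniform_limit {0..L} y u sequentially))"
    unfolding \<beta> by blast
qed

end
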